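(* Let $(M_1,F_1)$ and $(M_2,F_2)$ be Finsler manifolds, let $f: M_1\times M_2\to(0,\infty)$ be a smooth function, and let $F=\sqrt{F_1^2+f^2F_2^2}$ be the twisted product Finsler metric, defined on $\widetilde M$. Then $F$ has relatively isotropic mean Landsberg curvature if and only if $F$ is a weakly Landsberg metric.
   Context: A Finsler metric on a smooth manifold $N$ is a function $F:TN\to[0,\infty)$, smooth on the slit tangent bundle ($TN$ minus the zero section), with $F(x,\lambda y)=\lambda F(x,y)$ for $\lambda>0$, and with positive definite Hessian $g_{ij}=\frac12[F^2]_{y^iy^j}$ on the slit tangent bundle; $(g^{ij})$ is the inverse matrix and $y_i=g_{ij}y^j$. Here $(x^i,y^i)$ are induced local coordinates on $TN$, and the summation convention is used. The spray coefficients are $\mathbb G^i=\frac14 g^{ip}\{[F^2]_{x^qy^p}y^q-[F^2]_{x^p}\}$, the Berwald curvature coefficients are $B^{\ l}_{i\ jk}=\frac{\partial^3\mathbb G^l}{\partial y^i\partial y^j\partial y^k}$, the Landsberg curvature coefficients are $L_{ijk}=-\frac12 y_l B^{\ l}_{i\ jk}$, and the mean Landsberg curvature coefficients are $J_i=L_{ijk}g^{jk}$. $F$ is a weakly Landsberg metric if $J_i=0$ identically. The Cartan torsion coefficients are $C_{ijk}=\frac12\frac{\partial g_{ij}}{\partial y^k}$, and the mean Cartan torsion coefficients are $I_i=C_{ijk}g^{jk}$. $F$ has relatively isotropic mean Landsberg curvature if there is a scalar function $c=c(x)$ on the manifold with $J_i+c(x)F\,I_i=0$ for all $i$. Twisted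 product: with $m=\dim M_1$, $n=\dim M_2$, local coordinates on $M=M_1\times M_2$ are product coordinates $x=(x_1,x_2)$, $x_1=(x^1,\dots,x^m)$ on $M_1$, $x_2=(x^{m+1},\dots,x^{m+n})$ on $M_2$, with fibre coordinates $y=(y_1,y_2)$ accordingly. $\widetilde M=\widetilde M_1\times\widetilde M_2$ where $\widetilde M_i$ is $TM_i$ minus its zero section. The twisted product Finsler metric is $F(x,y)=\sqrt{F_1^2(x_1,y_1)+f^2(x_1,x_2)F_2^2(x_2,y_2)}$ on $\widetilde M$; its curvature quantities are computed on $\widetilde M$, with indices $\alpha,\beta,\gamma,\lambda,\mu,\nu$ running from $1$ to $m+n$, by $G_{\alpha\beta}=\frac12[F^2]_{y^\alpha y^\beta}$ with inverse matrix $(G^{\alpha\beta})$, spray coefficients $\mathbb G^\alpha=\frac14 G^{\alpha\mu}\{[F^2]_{x^\nu y^\mu}y^\nu-[F^2]_{x^\mu}\}$, Berwald curvature coefficients $B^{\ \lambda}_{\alpha\ \beta\gamma}=\frac{\partial^3\mathbb G^\lambda}{\partial y^\alpha\partial y^\beta\partial y^\gamma}$, Landsberg curvature coefficients $L_{\alpha\beta\gamma}=-\frac12 G_{\lambda\mu}y^\mu B^{\ \lambda}_{\alpha\ \beta\gamma}$, mean Landsberg curvature coefficients $J_\alpha=L_{\alpha\beta\gamma}G^{\beta\gamma}$, Cartan torsion coefficients $C_{\alpha\beta\gamma}=\frac12\frac{\partial G_{\alpha\beta}}{\partial y^\gamma}$, and mean Cartan torsion coefficients $I_\alpha=C_{\alpha\beta\gamma}G^{\beta\gamma}$.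 Thus the twisted product $F$ is a weakly Landsberg metric if $J_\alpha=0$ on $\widetilde M$ for all $\alpha$, and it has relatively isotropic mean Landsberg curvature if there is a scalar function $c=c(x)$ on $M$ with $J_\alpha+c(x)F\,I_\alpha=0$ on $\widetilde M$ for all $\alpha$. *)

theory Defs
  imports "HOL-Analysis.Analysis"
begin

section \<open>Smooth manifolds\<close>

text \<open>The predicates below are meant for open \<open>S\<close>; differentiability at a point is then
  not affected by the values outside \<open>S\<close>.\<close>

fun Ck_on :: "nat \<Rightarrow> 'a::real_normed_vector set \<Rightarrow> ('a \<Rightarrow> 'b::real_normed_vector) \<Rightarrow> bool" where
  "Ck_on 0 S f \<longleftrightarrow> continuous_on S f"
| "Ck_on (Suc k) S f \<longleftrightarrow>
     (\<forall>x\<in>S. f differentiable (at x)) \<and> (\<forall>v. Ck_on k S (\<lambda>x. frechet_derivative f (at x) v))"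

definition smooth_on :: "'a::real_normed_vector set \<Rightarrow> ('a \<Rightarrow> 'b::real_normed_vector) \<Rightarrow> bool" where
  "smooth_on S f \<longleftrightarrow> (\<forall>k. Ck_on k S f)"

text \<open>A chart is a pair of its domain and its coordinate map (whose values outside the domain are
  irrelevant).\<close>

type_synonym ('a, 'n) chart = "'a set \<times> ('a \<Rightarrow> real^'n)"

definition is_chart :: "'a topology \<Rightarrow> ('a, 'n::finite) chart \<Rightarrow> bool" where
  "is_chart X c \<longleftrightarrow> openin X (fst c) \<and> open (snd c ` fst c) \<and>
     homeomorphic_map (subtopology X (fst c)) (top_of_set (snd c ` fst c)) (snd c)"

definition chart_pt :: "('a, 'n::finite) chart \<Rightarrow> real^'n \<Rightarrow> 'a" where
  "chart_pt c x = inv_into (fst c) (snd c) x"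

definition smooth_manifold :: "'a topology \<Rightarrow> ('a, 'n::finite) chart set \<Rightarrow> bool" where
  "smooth_manifold X A \<longleftrightarrow>
     Hausdorff_space X \<and> second_countable X \<and>
     (\<forall>c\<in>A. is_chart X c) \<and> (\<Union>c\<in>A. fst c) = topspace X \<and>
     (\<forall>c\<in>A. \<forall>d\<in>A. smooth_on (snd c ` (fst c \<inter> fst d)) (snd d \<circ> chart_pt c))"

section \<open>Tangent bundle\<close>

text \<open>A tangent vector at \<open>p\<close> is the family of its components in all charts of the atlas
  around \<open>p\<close>, subject to the contravariant transformation law; the family is \<open>0\<close> at all other
  charts, so that it is determined by its components. An element of the tangent bundle is a pair of
  a base point and such a family.\<close>

type_synonym ('a, 'n) tvec = "('a, 'n) chart \<Rightarrow> real^'n"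

definition tangent_space :: "('a, 'n::finite) chart set \<Rightarrow> 'a \<Rightarrow> ('a, 'n) tvec set" where
  "tangent_space A p =
     {v. (\<forall>c\<in>A. \<forall>d\<in>A. p \<in> fst c \<inter> fst d \<longrightarrow>
            v d = frechet_derivative (snd d \<circ> chart_pt c) (at (snd c p)) (v c)) \<and>
         (\<forall>c. \<not> (c \<in> A \<and> p \<in> fst c) \<longrightarrow> v c = 0)}"

definition tangent_bundle ::
    "'a topology \<Rightarrow> ('a, 'n::finite) chart set \<Rightarrow> ('a \<times> ('a, 'n) tvec) set" where
  "tangent_bundle X A = (SIGMA p:topspace X. tangent_space A p)"

text \<open>The tangent vector at \<open>p\<close> whose component vector in the chart \<open>c\<close> is \<open>y\<close>.\<close>

definition tvec_of :: "('a, 'n::finite) chart set \<Rightarrow> ('a, 'n) chart \<Rightarrow> 'a \<Rightarrow> real^'n \<Rightarrow> ('a, 'n) tvec" where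
  "tvec_of A c p y =
     (\<lambda>d. if d \<in> A \<and> p \<in> fst d
          then frechet_derivative (snd d \<circ> chart_pt c) (at (snd c p)) y else 0)"

text \<open>The element of the tangent bundle with induced coordinates \<open>(x, y)\<close> in the chart \<open>c\<close>.\<close>

definition tcoord ::
    "('a, 'n::finite) chart set \<Rightarrow> ('a, 'n) chart \<Rightarrow> real^'n \<Rightarrow> real^'n \<Rightarrow> 'a \<times> ('a, 'n) tvec" where
  "tcoord A c x y = (chart_pt c x, tvec_of A c (chart_pt c x) y)"

section \<open>Curvature quantities in induced coordinates\<close>

text \<open>\<open>pderiv_at i h z\<close> is the partial derivative of \<open>h\<close> at \<open>z\<close> with respect to the \<open>i\<close>-th
  coordinate. Throughout this section \<open>F x y\<close> is the metric in induced coordinates \<open>(x, y)\<close>.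
  Iterated subscripts are taken in the order in which they are written.\<close>

definition pderiv_at :: "'k::finite \<Rightarrow> (real^'k \<Rightarrow> real) \<Rightarrow> real^'k \<Rightarrow> real" where
  "pderiv_at i h z = frechet_derivative h (at z) (axis i 1)"

definition fund_tensor :: "(real^'k::finite \<Rightarrow> real^'k \<Rightarrow> real) \<Rightarrow> real^'k \<Rightarrow> real^'k \<Rightarrow> real^'k^'k" where
  "fund_tensor F x y =
     (\<chi> i j. 1/2 * pderiv_at j (\<lambda>v. pderiv_at i (\<lambda>w. (F x w)\<^sup>2) v) y)"

definition fund_inv :: "(real^'k::finite \<Rightarrow> real^'k \<Rightarrow> real) \<Rightarrow> real^'k \<Rightarrow> real^'k \<Rightarrow> real^'k^'k" where
  "fund_inv F x y = matrix_inv (fund_tensor F x y)"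

definition lower_y :: "(real^'k::finite \<Rightarrow> real^'k \<Rightarrow> real) \<Rightarrow> real^'k \<Rightarrow> real^'k \<Rightarrow> 'k \<Rightarrow> real" where
  "lower_y F x y i = (\<Sum>j\<in>UNIV. fund_tensor F x y $ i $ j * y $ j)"

definition spray :: "(real^'k::finite \<Rightarrow> real^'k \<Rightarrow> real) \<Rightarrow> real^'k \<Rightarrow> real^'k \<Rightarrow> 'k \<Rightarrow> real" where
  "spray F x y i =
     1/4 * (\<Sum>p\<in>UNIV. fund_inv F x y $ i $ p *
        ((\<Sum>q\<in>UNIV. pderiv_at p (\<lambda>w. pderiv_at q (\<lambda>u. (F u w)\<^sup>2) x) y * y $ q)
         - pderiv_at p (\<lambda>u. (F u y)\<^sup>2) x))"

text \<open>\<open>berwald F x y i l j k\<close> is the coefficient with lower indices \<open>i, j, k\<close> and upper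
  index \<open>l\<close>.\<close>

definition berwald ::
    "(real^'k::finite \<Rightarrow> real^'k \<Rightarrow> real) \<Rightarrow> real^'k \<Rightarrow> real^'k \<Rightarrow> 'k \<Rightarrow> 'k \<Rightarrow> 'k \<Rightarrow> 'k \<Rightarrow> real" where
  "berwald F x y i l j k =
     pderiv_at i (\<lambda>u. pderiv_at j (\<lambda>v. pderiv_at k (\<lambda>w. spray F x w l) v) u) y"

definition landsberg ::
    "(real^'k::finite \<Rightarrow> real^'k \<Rightarrow> real) \<Rightarrow> real^'k \<Rightarrow> real^'k \<Rightarrow> 'k \<Rightarrow> 'k \<Rightarrow> 'k \<Rightarrow> real" where
  "landsberg F x y i j k = - (1/2) * (\<Sum>l\<in>UNIV. lower_y F x y l * berwald F x y i l j k)"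

definition mean_landsberg ::
    "(real^'k::finite \<Rightarrow> real^'k \<Rightarrow> real) \<Rightarrow> real^'k \<Rightarrow> real^'k \<Rightarrow> 'k \<Rightarrow> real" where
  "mean_landsberg F x y i =
     (\<Sum>j\<in>UNIV. \<Sum>k\<in>UNIV. landsberg F x y i j k * fund_inv F x y $ j $ k)"

definition cartan_torsion ::
    "(real^'k::finite \<Rightarrow> real^'k \<Rightarrow> real) \<Rightarrow> real^'k \<Rightarrow> real^'k \<Rightarrow> 'k \<Rightarrow> 'k \<Rightarrow> 'k \<Rightarrow> real" where
  "cartan_torsion F x y i j k = 1/2 * pderiv_at k (\<lambda>w. fund_tensor F x w $ i $ j) y"

definition mean_cartan ::
    "(real^'k::finite \<Rightarrow> real^'k \<Rightarrow> real) \<Rightarrow> real^'k \<Rightarrow> real^'k \<Rightarrow> 'k \<Rightarrow> real" where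
  "mean_cartan F x y i =
     (\<Sum>j\<in>UNIV. \<Sum>k\<in>UNIV. cartan_torsion F x y i j k * fund_inv F x y $ j $ k)"

section \<open>Finsler manifolds\<close>

definition local_metric ::
    "('a, 'n::finite) chart set \<Rightarrow> ('a, 'n) chart \<Rightarrow> ('a \<times> ('a, 'n) tvec \<Rightarrow> real) \<Rightarrow>
     real^'n \<Rightarrow> real^'n \<Rightarrow> real" where
  "local_metric A c F x y = F (tcoord A c x y)"

definition finsler_metric ::
    "'a topology \<Rightarrow> ('a, 'n::finite) chart set \<Rightarrow> ('a \<times> ('a, 'n) tvec \<Rightarrow> real) \<Rightarrow> bool" where
  "finsler_metric X A F \<longleftrightarrow>
     (\<forall>w\<in>tangent_bundle X A. F w \<ge> 0) \<and>
     (\<forall>(p, v)\<in>tangent_bundle X A. \<forall>s>0. F (p, (\<lambda>c. s *\<^sub>R v c)) = s * F (p, v)) \<and>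
     (\<forall>c\<in>A. smooth_on ((snd c ` fst c) \<times> (- {0})) (\<lambda>(x, y). local_metric A c F x y)) \<and>
     (\<forall>c\<in>A. \<forall>x\<in>snd c ` fst c. \<forall>y. y \<noteq> 0 \<longrightarrow>
        (\<forall>u. u \<noteq> 0 \<longrightarrow> u \<bullet> (fund_tensor (local_metric A c F) x y *v u) > 0))"

definition finsler_manifold ::
    "'a topology \<Rightarrow> ('a, 'n::finite) chart set \<Rightarrow> ('a \<times> ('a, 'n) tvec \<Rightarrow> real) \<Rightarrow> bool" where
  "finsler_manifold X A F \<longleftrightarrow> smooth_manifold X A \<and> finsler_metric X A F"

section \<open>Twisted products\<close>

text \<open>Product coordinates are indexed by the disjoint sum of the index types: \<open>Inl\<close> gives the
  coordinates of the first factor and \<open>Inr\<close> those of the second.\<close>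

definition fst_part :: "real^('m::finite + 'n::finite) \<Rightarrow> real^'m" where
  "fst_part x = (\<chi> i. x $ Inl i)"

definition snd_part :: "real^('m::finite + 'n::finite) \<Rightarrow> real^'n" where
  "snd_part x = (\<chi> j. x $ Inr j)"

definition smooth_on_product ::
    "('a, 'm::finite) chart set \<Rightarrow> ('b, 'n::finite) chart set \<Rightarrow> ('a \<times> 'b \<Rightarrow> real) \<Rightarrow> bool" where
  "smooth_on_product A1 A2 f \<longleftrightarrow>
     (\<forall>c1\<in>A1. \<forall>c2\<in>A2.
        smooth_on ((snd c1 ` fst c1) \<times> (snd c2 ` fst c2))
          (\<lambda>(x1, x2). f (chart_pt c1 x1, chart_pt c2 x2)))"

text \<open>The twisted product metric as a function of a pair of tangent vectors to the two factors.\<close>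

definition twisted_product ::
    "('a \<times> ('a, 'm::finite) tvec \<Rightarrow> real) \<Rightarrow> ('a \<times> 'b \<Rightarrow> real) \<Rightarrow>
     ('b \<times> ('b, 'n::finite) tvec \<Rightarrow> real) \<Rightarrow>
     ('a \<times> ('a, 'm) tvec) \<times> ('b \<times> ('b, 'n) tvec) \<Rightarrow> real" where
  "twisted_product F1 f F2 =
     (\<lambda>(w1, w2). sqrt ((F1 w1)\<^sup>2 + (f (fst w1, fst w2))\<^sup>2 * (F2 w2)\<^sup>2))"

definition local_product_metric ::
    "('a, 'm::finite) chart set \<Rightarrow> ('b, 'n::finite) chart set \<Rightarrow> ('a, 'm) chart \<Rightarrow> ('b, 'n) chart \<Rightarrow>
     (('a \<times> ('a, 'm) tvec) \<times> ('b \<times> ('b, 'n) tvec) \<Rightarrow> real) \<Rightarrow>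
     real^('m + 'n) \<Rightarrow> real^('m + 'n) \<Rightarrow> real" where
  "local_product_metric A1 A2 c1 c2 F x y =
     F (tcoord A1 c1 (fst_part x) (fst_part y), tcoord A2 c2 (snd_part x) (snd_part y))"

text \<open>The coordinate domain of the product of the two slit tangent bundles: both components of the
  tangent vector have to be nonzero.\<close>

definition product_slit_domain ::
    "('a, 'm::finite) chart \<Rightarrow> ('b, 'n::finite) chart \<Rightarrow> ((real^('m + 'n)) \<times> (real^('m + 'n))) set" where
  "product_slit_domain c1 c2 =
     {(x, y). fst_part x \<in> snd c1 ` fst c1 \<and> snd_part x \<in> snd c2 ` fst c2 \<and>
              fst_part y \<noteq> 0 \<and> snd_part y \<noteq> 0}"

definition weakly_landsberg ::
    "('a, 'm::finite) chart set \<Rightarrow> ('b, 'n::finite) chart set \<Rightarrow>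
     (('a \<times> ('a, 'm) tvec) \<times> ('b \<times> ('b, 'n) tvec) \<Rightarrow> real) \<Rightarrow> bool" where
  "weakly_landsberg A1 A2 F \<longleftrightarrow>
     (\<forall>c1\<in>A1. \<forall>c2\<in>A2. \<forall>(x, y)\<in>product_slit_domain c1 c2. \<forall>\<alpha>.
        mean_landsberg (local_product_metric A1 A2 c1 c2 F) x y \<alpha> = 0)"

definition rel_isotropic_mean_landsberg ::
    "('a, 'm::finite) chart set \<Rightarrow> ('b, 'n::finite) chart set \<Rightarrow>
     (('a \<times> ('a, 'm) tvec) \<times> ('b \<times> ('b, 'n) tvec) \<Rightarrow> real) \<Rightarrow> bool" where
  "rel_isotropic_mean_landsberg A1 A2 F \<longleftrightarrow>
     (\<exists>c :: 'a \<times> 'b \<Rightarrow> real.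
        \<forall>c1\<in>A1. \<forall>c2\<in>A2. \<forall>(x, y)\<in>product_slit_domain c1 c2. \<forall>\<alpha>.
          mean_landsberg (local_product_metric A1 A2 c1 c2 F) x y \<alpha>
          + c (chart_pt c1 (fst_part x), chart_pt c2 (snd_part x))
            * local_product_metric A1 A2 c1 c2 F x y
            * mean_cartan (local_product_metric A1 A2 c1 c2 F) x y \<alpha> = 0)"

end

theory Submission
  imports Defs
begin

text \<open>Only one implication has content, and it is decided in a single product of fibres: fix the base
  point \<open>x\<close> and replace \<open>y = (y\<^sub>1, y\<^sub>2)\<close> by \<open>(y\<^sub>1, t y\<^sub>2)\<close> with \<open>t > 0\<close>. The idea is that the mean
  Landsberg curvature of a twisted product depends on \<open>t\<close> polynomially, whereas \<open>F\<close> itself is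
  \<open>sqrt (F\<^sub>1\<^sup>2 + t\<^sup>2 f\<^sup>2 F\<^sub>2\<^sup>2)\<close>, which is not a polynomial in \<open>t\<close>, so that in
  \<open>J\<^sub>\<alpha> + c F I\<^sub>\<alpha> = 0\<close> the two terms cannot cancel.

  In detail, \<open>F\<^sup>2 = F\<^sub>1\<^sup>2(x\<^sub>1, y\<^sub>1) + f\<^sup>2(x) F\<^sub>2\<^sup>2(x\<^sub>2, y\<^sub>2)\<close> makes the fundamental tensor block diagonal, and the
  definition of the spray then gives
  \<open>G\<^sup>l = a\<^sub>l(y\<^sub>1) + U\<^sub>l(y\<^sub>1) F\<^sub>2\<^sup>2(y\<^sub>2)\<close> for the first factor and
  \<open>G\<^sup>c = P\<^sub>c(y\<^sub>2) + q(y\<^sub>1) Q\<^sub>c(y\<^sub>2)\<close> for the second, where \<open>F\<^sub>2\<^sup>2\<close>, \<open>P\<^sub>c\<close>, \<open>Q\<^sub>c\<close> are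
  positively homogeneous of degrees 2, 2 and 1 (lemmas \<open>spray_eq\<close> and \<open>pos_homog_spray\<close>). Hence the
  Berwald coefficients are sums of products of a function of \<open>y\<^sub>1\<close> and a homogeneous function of \<open>y\<^sub>2\<close>,
  every derivative in a direction of the second factor lowers the degree in \<open>t\<close> by one, and counting
  degrees shows that \<open>J\<^sub>i\<close>, for an index of the first factor, and \<open>t J\<^sub>a\<close>, for an index of the second
  factor, are polynomials of degree at most two in \<open>t\<close> (\<open>quadratic_mean_landsberg\<close>). In the same
  scaling \<open>I\<^sub>i\<close> and \<open>t I\<^sub>a\<close> do not depend on \<open>t\<close> (\<open>mean_cartan_scale_snd\<close>). The hypothesis so reads
  \<open>p(t) + k sqrt (A + B t\<^sup>2) = 0\<close> for all \<open>t > 0\<close>, with \<open>p\<close> quadratic, \<open>k = c I\<^sub>i\<close> or \<open>k = c I\<^sub>a\<close>, and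
  \<open>A, B > 0\<close>; squaring and comparing coefficients yields \<open>k = 0\<close> (\<open>sqrt_not_quadratic\<close>), that is
  \<open>c I\<^sub>\<alpha> = 0\<close> and therefore \<open>J\<^sub>\<alpha> = 0\<close>.

  The curvature quantities are iterated Frechet derivatives, which are meaningful only for
  differentiable functions; this is why a calculus of smooth functions comes first. The
  homogeneity of \<open>F\<^sub>2\<close> in coordinates rests on the fact that induced coordinates do describe
  elements of the tangent bundle (\<open>tcoord_in_tangent_bundle\<close>), which is the chain rule for
  transition maps.\<close>

section \<open>Calculus of smooth functions\<close>

lemma frechet_derivative_cong_open:
  assumes "open S" "x \<in> S" "\<And>z. z \<in> S \<Longrightarrow> f z = g z"
  shows "frechet_derivative f (at x) = frechet_derivative g (at x)"
proof -
  have "(f has_derivative D) (at x) \<longleftrightarrow> (g has_derivative D) (at x)" for D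
    using has_derivative_transform_within_open[OF _ assms(1,2), of f D UNIV g]
      has_derivative_transform_within_open[OF _ assms(1,2), of g D UNIV f] assms(3) by auto
  then show ?thesis
    by (simp add: frechet_derivative_def)
qed

lemma differentiable_cong_open:
  assumes "open S" "x \<in> S" "\<And>z. z \<in> S \<Longrightarrow> f z = g z" "f differentiable (at x)"
  shows "g differentiable (at x)"
proof -
  obtain D where "(f has_derivative D) (at x)"
    using assms(4) unfolding differentiable_def by blast
  then have "(g has_derivative D) (at x)"
    by (rule has_derivative_transform_within_open[OF _ assms(1,2)]) (rule assms(3))
  then show ?thesis
    unfolding differentiable_def by blast
qed

lemma Ck_on_cong:
  assumes "open S" "\<And>z. z \<in> S \<Longrightarrow> f z = g z" "Ck_on k S f"
  shows "Ck_on k S g"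
  using assms(2,3)
proof (induction k arbitrary: f g)
  case 0
  then show ?case by (simp cong: continuous_on_cong)
next
  case (Suc k)
  have "g differentiable (at x)" if "x \<in> S" for x
    using Suc.prems that differentiable_cong_open[OF assms(1) that, of f g] by simp
  moreover have "Ck_on k S (\<lambda>x. frechet_derivative g (at x) v)" for v
  proof (rule Suc.IH)
    show "Ck_on k S (\<lambda>x. frechet_derivative f (at x) v)" using Suc.prems by simp
    show "frechet_derivative f (at z) v = frechet_derivative g (at z) v" if "z \<in> S" for z
      using frechet_derivative_cong_open[OF assms(1) that, of f g] Suc.prems(1) by simp
  qed
  ultimately show ?case by simp
qed

text \<open>The defining equation of \<^const>\<open>Ck_on\<close> speaks of \<^const>\<open>frechet_derivative\<close>; in proofs a
  derivative is known as a formula, valid on \<open>S\<close> only, and this rule mediates between the two.\<close>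

lemma Ck_on_SucI:
  assumes "open S" "\<And>x. x \<in> S \<Longrightarrow> (f has_derivative D x) (at x)" "\<And>v. Ck_on k S (\<lambda>x. D x v)"
  shows "Ck_on (Suc k) S f"
proof -
  have "frechet_derivative f (at x) = D x" if "x \<in> S" for x
    using frechet_derivative_at[OF assms(2)[OF that]] by simp
  then have "Ck_on k S (\<lambda>x. frechet_derivative f (at x) v)" for v
    by (intro Ck_on_cong[OF assms(1) _ assms(3)[of v]]) simp
  then show ?thesis
    using assms(2) by (auto simp: differentiable_def)
qed

lemma Ck_on_SucD:
  assumes "Ck_on (Suc k) S f"
  shows "Ck_on k S f"
  using assms
proof (induction k arbitrary: f)
  case 0
  then have "f differentiable_on S"
    by (simp add: differentiable_on_def differentiable_at_withinI)
  then show ?case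
    by (simp add: differentiable_imp_continuous_on)
next
  case (Suc k)
  then show ?case
    using Ck_on.simps(2)[of "Suc k" S f] Ck_on.simps(2)[of k S f] by blast
qed

lemma Ck_on_has_derivative:
  assumes "Ck_on (Suc k) S f" "x \<in> S"
  shows "(f has_derivative frechet_derivative f (at x)) (at x)"
  using assms by (simp add: frechet_derivative_works)

lemma Ck_on_const: "Ck_on k S (\<lambda>x. c)"
  by (induction k arbitrary: c) simp_all

lemma Ck_on_add:
  assumes "open S" "Ck_on k S f" "Ck_on k S g"
  shows "Ck_on k S (\<lambda>x. f x + g x)"
  using assms(2,3)
proof (induction k arbitrary: f g)
  case 0
  then show ?case by (simp add: continuous_on_add)
next
  case (Suc k)
  have "((\<lambda>x. f x + g x) has_derivative
      (\<lambda>v. frechet_derivative f (at x) v + frechet_derivative g (at x) v)) (at x)"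
    if "x \<in> S" for x
    by (rule has_derivative_add[OF Suc.prems[THEN Ck_on_has_derivative, OF that]])
  moreover have "Ck_on k S (\<lambda>x. frechet_derivative f (at x) v + frechet_derivative g (at x) v)" for v
    using Suc.prems by (intro Suc.IH) simp_all
  ultimately show ?case
    by (rule Ck_on_SucI[OF assms(1)])
qed

lemma Ck_on_mult:
  fixes f g :: "'a::real_normed_vector \<Rightarrow> real"
  assumes "open S" "Ck_on k S f" "Ck_on k S g"
  shows "Ck_on k S (\<lambda>x. f x * g x)"
  using assms(2,3)
proof (induction k arbitrary: f g)
  case 0
  then show ?case by (simp add: continuous_on_mult)
next
  case (Suc k)
  have "((\<lambda>x. f x * g x) has_derivative
      (\<lambda>v. f x * frechet_derivative g (at x) v + frechet_derivative f (at x) v * g x)) (at x)"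
    if "x \<in> S" for x
    by (rule has_derivative_mult[OF Suc.prems[THEN Ck_on_has_derivative, OF that]])
  moreover have
    "Ck_on k S (\<lambda>x. f x * frechet_derivative g (at x) v + frechet_derivative f (at x) v * g x)" for v
    using Suc.prems Suc.prems[THEN Ck_on_SucD] by (intro Ck_on_add Suc.IH assms(1)) simp_all
  ultimately show ?case
    by (rule Ck_on_SucI[OF assms(1)])
qed

lemma Ck_on_inverse:
  fixes f :: "'a::real_normed_vector \<Rightarrow> real"
  assumes "open S" "\<And>x. x \<in> S \<Longrightarrow> f x \<noteq> 0" "Ck_on k S f"
  shows "Ck_on k S (\<lambda>x. inverse (f x))"
  using assms(3)
proof (induction k)
  case 0
  then show ?case using assms(2) by (simp add: continuous_on_inverse)
next
  case (Suc k)
  have "((\<lambda>x. inverse (f x)) has_derivative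
      (\<lambda>v. - (inverse (f x) * frechet_derivative f (at x) v * inverse (f x)))) (at x)"
    if "x \<in> S" for x
    by (rule Deriv.has_derivative_inverse[OF assms(2)[OF that] Ck_on_has_derivative[OF Suc.prems that]])
  moreover have
    "Ck_on k S (\<lambda>x. (-1) * (inverse (f x) * frechet_derivative f (at x) v * inverse (f x)))" for v
    using Suc.prems Suc.IH[OF Suc.prems[THEN Ck_on_SucD]]
    by (intro Ck_on_mult Ck_on_const assms(1)) simp_all
  then have "Ck_on k S (\<lambda>x. - (inverse (f x) * frechet_derivative f (at x) v * inverse (f x)))" for v
    by simp
  ultimately show ?case
    by (rule Ck_on_SucI[OF assms(1)])
qed

text \<open>Used to restrict a smooth function of \<open>(x, y)\<close> to a fibre. The induction is immediate because the
  inner map is affine, so that the direction \<open>L v\<close> in which \<open>f\<close> is differentiated is constant.\<close>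

lemma Ck_on_affine_comp:
  assumes "open S" "bounded_linear L" "\<And>x. x \<in> S \<Longrightarrow> c + L x \<in> T" "Ck_on k T f"
  shows "Ck_on k S (\<lambda>x. f (c + L x))"
  using assms(4)
proof (induction k arbitrary: f)
  case 0
  have "continuous_on S (\<lambda>x. c + L x)"
    by (intro continuous_intros linear_continuous_on assms(2))
  then show ?case
    using 0 assms(3) continuous_on_compose2[of T f S "\<lambda>x. c + L x"] by auto
next
  case (Suc k)
  have L: "((\<lambda>x. c + L x) has_derivative L) (at x)" for x
    using has_derivative_add[OF has_derivative_const bounded_linear_imp_has_derivative[OF assms(2)]]
    by simp
  have "((\<lambda>x. f (c + L x)) has_derivative (\<lambda>v. frechet_derivative f (at (c + L x)) (L v))) (at x)"
    if "x \<in> S" for x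
    by (rule has_derivative_compose[OF L Ck_on_has_derivative[OF Suc.prems assms(3)[OF that]]])
  moreover have "Ck_on k S (\<lambda>x. frechet_derivative f (at (c + L x)) (L v))" for v
    using Suc.prems by (intro Suc.IH) simp
  ultimately show ?case
    by (rule Ck_on_SucI[OF assms(1)])
qed

lemma smooth_on_Ck_on: "smooth_on S f \<Longrightarrow> Ck_on k S f"
  by (simp only: smooth_on_def)

lemma smooth_on_cong:
  assumes "open S" "\<And>z. z \<in> S \<Longrightarrow> f z = g z" "smooth_on S f"
  shows "smooth_on S g"
  unfolding smooth_on_def by (intro allI Ck_on_cong[OF assms(1,2) smooth_on_Ck_on[OF assms(3)]])

lemma smooth_on_const: "smooth_on S (\<lambda>x. c)"
  unfolding smooth_on_def by (intro allI Ck_on_const)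

lemma smooth_on_add:
  assumes "open S" "smooth_on S f" "smooth_on S g"
  shows "smooth_on S (\<lambda>x. f x + g x)"
  unfolding smooth_on_def by (intro allI Ck_on_add assms smooth_on_Ck_on)

lemma smooth_on_mult:
  fixes f g :: "'a::real_normed_vector \<Rightarrow> real"
  assumes "open S" "smooth_on S f" "smooth_on S g"
  shows "smooth_on S (\<lambda>x. f x * g x)"
  unfolding smooth_on_def by (intro allI Ck_on_mult assms smooth_on_Ck_on)

lemma smooth_on_inverse:
  fixes f :: "'a::real_normed_vector \<Rightarrow> real"
  assumes "open S" "\<And>x. x \<in> S \<Longrightarrow> f x \<noteq> 0" "smooth_on S f"
  shows "smooth_on S (\<lambda>x. inverse (f x))"
  unfolding smooth_on_def by (intro allI Ck_on_inverse assms smooth_on_Ck_on)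

lemma smooth_on_diff:
  fixes f g :: "'a::real_normed_vector \<Rightarrow> real"
  assumes "open S" "smooth_on S f" "smooth_on S g"
  shows "smooth_on S (\<lambda>x. f x - g x)"
  using smooth_on_add[OF assms(1,2) smooth_on_mult[OF assms(1) smooth_on_const assms(3)], of "-1"]
  by simp

lemma smooth_on_sum:
  assumes "open S" "\<And>i. i \<in> I \<Longrightarrow> smooth_on S (f i)"
  shows "smooth_on S (\<lambda>x. \<Sum>i\<in>I. f i x)"
  using assms(2)
proof (induction I rule: infinite_finite_induct)
  case (insert j J)
  have "smooth_on S (\<lambda>x. f j x + (\<Sum>i\<in>J. f i x))"
    by (intro smooth_on_add assms(1) insert) simp_all
  then show ?case
    using insert.hyps by simp
qed (simp_all add: smooth_on_const)

lemma smooth_on_prod: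
  fixes f :: "'i \<Rightarrow> 'a::real_normed_vector \<Rightarrow> real"
  assumes "open S" "\<And>i. i \<in> I \<Longrightarrow> smooth_on S (f i)"
  shows "smooth_on S (\<lambda>x. \<Prod>i\<in>I. f i x)"
  using assms(2)
proof (induction I rule: infinite_finite_induct)
  case (insert j J)
  have "smooth_on S (\<lambda>x. f j x * (\<Prod>i\<in>J. f i x))"
    by (intro smooth_on_mult assms(1) insert) simp_all
  then show ?case
    using insert.hyps by simp
qed (simp_all add: smooth_on_const)

lemma smooth_on_affine_comp:
  assumes "open S" "bounded_linear L" "\<And>x. x \<in> S \<Longrightarrow> c + L x \<in> T" "smooth_on T f"
  shows "smooth_on S (\<lambda>x. f (c + L x))"
  unfolding smooth_on_def
  by (intro allI Ck_on_affine_comp[where T = T] assms smooth_on_Ck_on)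

lemma smooth_on_has_derivative:
  assumes "smooth_on S f" "x \<in> S"
  shows "(f has_derivative frechet_derivative f (at x)) (at x)"
  using Ck_on_has_derivative[OF smooth_on_Ck_on[OF assms(1)] assms(2)] .

lemma smooth_on_frechet_derivative:
  assumes "smooth_on S f"
  shows "smooth_on S (\<lambda>x. frechet_derivative f (at x) v)"
  unfolding smooth_on_def
proof
  show "Ck_on k S (\<lambda>x. frechet_derivative f (at x) v)" for k
    using smooth_on_Ck_on[OF assms, of "Suc k"] by simp
qed

lemma smooth_on_nth:
  fixes S :: "(real^'k::finite) set"
  assumes "open S" shows "smooth_on S (\<lambda>x. x $ i)"
  unfolding smooth_on_def
proof
  fix k
  have *: "((\<lambda>x. x $ i) has_derivative (\<lambda>v. v $ i)) (at x)" for x :: "real^'k"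
    by (rule bounded_linear_imp_has_derivative[OF bounded_linear_vec_nth])
  show "Ck_on k S (\<lambda>x. x $ i)"
  proof (cases k)
    case 0
    then show ?thesis by (auto intro!: continuous_intros)
  next
    case (Suc l)
    show ?thesis unfolding Suc by (rule Ck_on_SucI[OF assms * Ck_on_const])
  qed
qed

lemma smooth_on_pderiv_at: "smooth_on S f \<Longrightarrow> smooth_on S (pderiv_at i f)"
  using smooth_on_frechet_derivative by (simp add: pderiv_at_def[abs_def])

lemma smooth_on_det:
  fixes M :: "'a::real_normed_vector \<Rightarrow> real^'k^'k::finite"
  assumes "open S" "\<And>i j. smooth_on S (\<lambda>x. M x $ i $ j)"
  shows "smooth_on S (\<lambda>x. det (M x))"
  unfolding det_def
  by (rule smooth_on_sum[OF assms(1) smooth_on_mult[OF assms(1) smooth_on_const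
          smooth_on_prod[OF assms]]])

lemma matrix_inv_eqI:
  fixes A :: "'a::semiring_1^'n^'n"
  assumes "A ** B = mat 1" "B ** A = mat 1"
  shows "matrix_inv A = B"
proof -
  have inv: "A ** matrix_inv A = mat 1 \<and> matrix_inv A ** A = mat 1"
    unfolding matrix_inv_def by (rule someI[of _ B]) (use assms in simp)
  have "matrix_inv A = matrix_inv A ** (A ** B)"
    using assms by simp
  also have "\<dots> = B"
    using inv by (simp add: matrix_mul_assoc)
  finally show ?thesis .
qed

lemma matrix_inv_inverse:
  fixes A :: "'a::field^'n^'n"
  assumes "det A \<noteq> 0"
  shows "A ** matrix_inv A = mat 1" "matrix_inv A ** A = mat 1"
proof -
  obtain B where "A ** B = mat 1" "B ** A = mat 1"
    using assms unfolding invertible_det_nz[symmetric] invertible_def by blast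
  then show "A ** matrix_inv A = mat 1" "matrix_inv A ** A = mat 1"
    using matrix_inv_eqI[of A B] by simp_all
qed

text \<open>By Cramer's rule the entries of the inverse are quotients of determinants, which are polynomials in
  the entries of the matrix.\<close>

lemma smooth_on_matrix_inv:
  fixes M :: "'a::real_normed_vector \<Rightarrow> real^'k^'k::finite"
  assumes "open S" "\<And>i j. smooth_on S (\<lambda>x. M x $ i $ j)" "\<And>x. x \<in> S \<Longrightarrow> det (M x) \<noteq> 0"
  shows "smooth_on S (\<lambda>x. matrix_inv (M x) $ i $ j)"
proof -
  \<comment> \<open>The matrix of Cramer's rule for the \<open>i\<close>-th component of the \<open>j\<close>-th column of the inverse.\<close>
  define N where "N x = (\<chi> r c. if c = i then axis j 1 $ r else M x $ r $ c)" for x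
  have N: "det (N x) * inverse (det (M x)) = matrix_inv (M x) $ i $ j" if "x \<in> S" for x
  proof -
    let ?z = "matrix_inv (M x) *v axis j 1"
    have "M x *v ?z = axis j 1"
      by (simp add: matrix_vector_mul_assoc matrix_inv_inverse[OF assms(3)[OF that]])
    then have "det (N x) = ?z $ i * det (M x)"
      using cramer_lemma[of i "M x" ?z] by (simp only: N_def)
    then show ?thesis
      using assms(3)[OF that] by (simp add: matrix_vector_mult_basis column_def)
  qed
  have "smooth_on S (\<lambda>x. N x $ r $ c)" for r c
    by (cases "c = i") (simp_all add: N_def smooth_on_const assms(2))
  then have "smooth_on S (\<lambda>x. det (N x) * inverse (det (M x)))"
    by (intro smooth_on_mult smooth_on_det smooth_on_inverse assms(1,3))
      (simp_all add: assms(2))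
  then show ?thesis
    using smooth_on_cong[OF assms(1) N] by simp
qed

section \<open>Positively homogeneous functions\<close>

text \<open>Degrees are integers, since three derivatives of a function of degree 1 or 2 have negative
  degree. The origin is excluded: functions of negative degree have a singularity there, and a Finsler metric is
  smooth on the slit tangent bundle only.\<close>

definition pos_homog :: "int \<Rightarrow> (real^'k::finite \<Rightarrow> real) \<Rightarrow> bool" where
  "pos_homog k v \<longleftrightarrow> (\<forall>t>0. \<forall>w. w \<noteq> 0 \<longrightarrow> v (t *\<^sub>R w) = t powi k * v w)"

lemma pos_homogD: "pos_homog k v \<Longrightarrow> t > 0 \<Longrightarrow> w \<noteq> 0 \<Longrightarrow> v (t *\<^sub>R w) = t powi k * v w"
  by (simp add: pos_homog_def)

lemma pos_homog_const: "pos_homog 0 (\<lambda>w. c)"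
  by (simp add: pos_homog_def)

lemma pos_homog_nth: "pos_homog 1 (\<lambda>w. w $ i)"
  by (simp add: pos_homog_def)

lemma pos_homog_add: "pos_homog k u \<Longrightarrow> pos_homog k v \<Longrightarrow> pos_homog k (\<lambda>w. u w + v w)"
  by (simp add: pos_homog_def algebra_simps)

lemma pos_homog_diff: "pos_homog k u \<Longrightarrow> pos_homog k v \<Longrightarrow> pos_homog k (\<lambda>w. u w - v w)"
  by (simp add: pos_homog_def algebra_simps)

lemma pos_homog_sum:
  "(\<And>i. i \<in> I \<Longrightarrow> pos_homog k (v i)) \<Longrightarrow> pos_homog k (\<lambda>w. \<Sum>i\<in>I. v i w)"
  by (simp add: pos_homog_def sum_distrib_left)

lemma pos_homog_mult:
  assumes "pos_homog k u" "pos_homog l v" "n = k + l"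
  shows "pos_homog n (\<lambda>w. u w * v w)"
  using assms by (simp add: pos_homog_def power_int_add)

lemma pos_homog_cmult: "pos_homog k v \<Longrightarrow> pos_homog k (\<lambda>w. c * v w)"
  by (simp add: pos_homog_def)

lemma pderiv_at_cong_open:
  assumes "open S" "x \<in> S" "\<And>z. z \<in> S \<Longrightarrow> f z = g z"
  shows "pderiv_at i f x = pderiv_at i g x"
  by (simp add: pderiv_at_def frechet_derivative_cong_open[OF assms])

lemma pderiv_at_eqI:
  assumes "(f has_derivative D) (at x)"
  shows "pderiv_at i f x = D (axis i 1)"
  by (simp add: pderiv_at_def frechet_derivative_at[OF assms, symmetric])

lemma pderiv_at_const [simp]: "pderiv_at i (\<lambda>w. c) = (\<lambda>w. 0)"
  by (simp add: pderiv_at_def[abs_def])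

lemma open_compl_zero: "open (- {0 :: real^'k::finite})"
  by (simp add: open_Compl)

text \<open>Differentiating \<open>v (t *\<^sub>R w) = t powi k * v w\<close> in \<open>w\<close> produces a factor \<open>t\<close> on the left only.\<close>

lemma pos_homog_pderiv_at:
  fixes v :: "real^'k::finite \<Rightarrow> real"
  assumes "smooth_on (-{0}) v" "pos_homog k v"
  shows "pos_homog (k - 1) (pderiv_at i v)"
  unfolding pos_homog_def
proof (intro allI impI)
  fix t :: real and w :: "real^'k"
  assume t: "t > 0" and w: "w \<noteq> 0"
  define e :: "real^'k" where "e = axis i 1"
  have D: "(v has_derivative frechet_derivative v (at z)) (at z)" if "z \<noteq> 0" for z
    using smooth_on_has_derivative[OF assms(1)] that by simp
  have sc: "((\<lambda>z. t *\<^sub>R z) has_derivative (\<lambda>z. t *\<^sub>R z)) (at w)"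
    by (rule bounded_linear_imp_has_derivative[OF bounded_linear_scaleR_right])
  have "((\<lambda>z. v (t *\<^sub>R z)) has_derivative (\<lambda>z. frechet_derivative v (at (t *\<^sub>R w)) (t *\<^sub>R z))) (at w)"
    by (rule has_derivative_compose[OF sc D]) (use t w in simp)
  moreover have "((\<lambda>z. t powi k * v z) has_derivative (\<lambda>z. t powi k * frechet_derivative v (at w) z)) (at w)"
    by (rule has_derivative_mult_right[OF D[OF w]])
  moreover have "frechet_derivative (\<lambda>z. v (t *\<^sub>R z)) (at w) = frechet_derivative (\<lambda>z. t powi k * v z) (at w)"
    by (rule frechet_derivative_cong_open[OF open_compl_zero])
      (use w t pos_homogD[OF assms(2)] in auto)
  ultimately have "(\<lambda>z. frechet_derivative v (at (t *\<^sub>R w)) (t *\<^sub>R z))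
      = (\<lambda>z. t powi k * frechet_derivative v (at w) z)"
    by (simp only: frechet_derivative_at[symmetric])
  then have "frechet_derivative v (at (t *\<^sub>R w)) (t *\<^sub>R e) = t powi k * frechet_derivative v (at w) e"
    by (rule fun_cong)
  moreover have "frechet_derivative v (at (t *\<^sub>R w)) (t *\<^sub>R e) = t * frechet_derivative v (at (t *\<^sub>R w)) e"
    using has_derivative_linear[OF D] t w by (simp add: linear_cmul)
  ultimately show "pderiv_at i v (t *\<^sub>R w) = t powi (k - 1) * pderiv_at i v w"
    using t by (simp add: pderiv_at_def e_def[symmetric] power_int_diff field_simps)
qed

lemma frechet_derivative_eq_sum_pderiv_at:
  fixes v :: "real^'k::finite \<Rightarrow> real"
  assumes "v differentiable (at w)"
  shows "frechet_derivative v (at w) z = (\<Sum>i\<in>UNIV. z $ i * pderiv_at i v w)"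
proof -
  have lin: "linear (frechet_derivative v (at w))"
    by (rule linear_frechet_derivative[OF assms])
  have "frechet_derivative v (at w) z = frechet_derivative v (at w) (\<Sum>i\<in>UNIV. z $ i *\<^sub>R axis i 1)"
    using basis_expansion[of z] by (simp add: scalar_mult_eq_scaleR)
  then show ?thesis
    by (simp add: linear_sum[OF lin] linear_cmul[OF lin] pderiv_at_def)
qed

text \<open>Euler's relation: the derivative of \<open>v (t *\<^sub>R w) = t powi k * v w\<close> in \<open>t\<close>, at \<open>t = 1\<close>.\<close>

lemma euler_pos_homog:
  fixes v :: "real^'k::finite \<Rightarrow> real"
  assumes "smooth_on (-{0}) v" "pos_homog k v" "w \<noteq> 0"
  shows "(\<Sum>i\<in>UNIV. w $ i * pderiv_at i v w) = of_int k * v w"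
proof -
  have D: "(v has_derivative frechet_derivative v (at w)) (at w)"
    using smooth_on_has_derivative[OF assms(1)] assms(3) by simp
  have L: "((\<lambda>t. t *\<^sub>R w) has_derivative (\<lambda>t. t *\<^sub>R w)) (at (1::real))"
    by (rule bounded_linear_imp_has_derivative[OF bounded_linear_scaleR_left])
  have "((\<lambda>t. v (t *\<^sub>R w)) has_derivative (\<lambda>t. frechet_derivative v (at w) (t *\<^sub>R w))) (at 1)"
    by (rule has_derivative_compose[OF L]) (use D in simp)
  then have "((\<lambda>t. t powi k * v w) has_derivative (\<lambda>t. frechet_derivative v (at w) (t *\<^sub>R w))) (at 1)"
    by (rule has_derivative_transform_within_open[OF _ open_greaterThan[of 0]])
      (use pos_homogD[OF assms(2) _ assms(3)] in auto)
  moreover have "((\<lambda>t. t powi k * v w) has_derivative (\<lambda>t. t * (of_int k * v w))) (at (1::real))"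
    by (rule has_derivative_eq_rhs, rule has_derivative_mult_left, rule has_derivative_power_int')
      (auto simp: fun_eq_iff)
  ultimately have "(\<lambda>t. frechet_derivative v (at w) (t *\<^sub>R w)) = (\<lambda>t. t * (of_int k * v w))"
    by (rule has_derivative_unique)
  from fun_cong[OF this, of 1] have "frechet_derivative v (at w) w = of_int k * v w"
    by simp
  then show ?thesis
    using frechet_derivative_eq_sum_pderiv_at[OF differentiableI[OF D], of w] by simp
qed

text \<open>For \<open>e = F\<^sup>2\<close> restricted to one tangent space this is the fundamental tensor of \<open>F\<close>.\<close>

definition half_hessian :: "(real^'k::finite \<Rightarrow> real) \<Rightarrow> real^'k \<Rightarrow> real^'k^'k" where
  "half_hessian e w = (\<chi> i j. 1/2 * pderiv_at j (pderiv_at i e) w)"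

lemma pos_def_det_nonzero:
  fixes A :: "real^'k^'k::finite"
  assumes "\<And>u. u \<noteq> 0 \<Longrightarrow> u \<bullet> (A *v u) > 0"
  shows "det A \<noteq> 0"
proof -
  have "u = 0" if "A *v u = 0" for u
    using assms[of u] that by auto
  then show ?thesis
    unfolding invertible_det_nz[symmetric] invertible_left_inverse matrix_left_invertible_ker by simp
qed

text \<open>Applying Euler's relation to \<open>e\<close> and to its first derivatives gives
  \<open>w \<bullet> (half_hessian e w *v w) = e w\<close>. This is how a Finsler metric is seen to be positive away from
  the zero section, which its definition does not demand explicitly.\<close>

lemma pos_homog_2_positive:
  assumes "smooth_on (-{0}) e" "pos_homog 2 e" "w \<noteq> 0"
    and "\<And>u. u \<noteq> 0 \<Longrightarrow> u \<bullet> (half_hessian e w *v u) > 0"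
  shows "e w > 0"
proof -
  have "(\<Sum>j\<in>UNIV. w $ j * pderiv_at j (pderiv_at i e) w) = pderiv_at i e w" for i
    using euler_pos_homog[OF smooth_on_pderiv_at[OF assms(1)] pos_homog_pderiv_at[OF assms(1,2)] assms(3)]
    by simp
  then have "(half_hessian e w *v w) $ i = 1/2 * pderiv_at i e w" for i
    by (simp add: half_hessian_def matrix_vector_mult_def sum_distrib_left mult_ac flip: sum_divide_distrib)
  then have "half_hessian e w *v w = (\<chi> i. 1/2 * pderiv_at i e w)"
    by (simp add: vec_eq_iff)
  then have "w \<bullet> (half_hessian e w *v w) = 1/2 * (\<Sum>i\<in>UNIV. w $ i * pderiv_at i e w)"
    by (simp add: inner_vec_def sum_divide_distrib)
  also have "\<dots> = e w"
    using euler_pos_homog[OF assms(1,2,3)] by simp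
  finally show ?thesis
    using assms(4)[OF assms(3)] by simp
qed

lemma half_hessian_nth: "half_hessian e w $ i $ j = 1/2 * pderiv_at j (pderiv_at i e) w"
  by (simp add: half_hessian_def)

lemma smooth_on_half_hessian:
  assumes "open S" "smooth_on S e"
  shows "smooth_on S (\<lambda>w. half_hessian e w $ i $ j)"
  unfolding half_hessian_nth
  by (rule smooth_on_mult[OF assms(1) smooth_on_const smooth_on_pderiv_at[OF smooth_on_pderiv_at[OF assms(2)]]])

lemma pos_homog_half_hessian:
  assumes "smooth_on (-{0}) e" "pos_homog 2 e"
  shows "pos_homog 0 (\<lambda>w. half_hessian e w $ i $ j)"
  unfolding half_hessian_nth
  using pos_homog_pderiv_at[OF smooth_on_pderiv_at[OF assms(1)] pos_homog_pderiv_at[OF assms]]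
  by (intro pos_homog_cmult) simp

lemma pos_homog_matrix_inv:
  fixes M :: "real^'k::finite \<Rightarrow> real^'l^'l::finite"
  assumes "\<And>i j. pos_homog 0 (\<lambda>w. M w $ i $ j)"
  shows "pos_homog 0 (\<lambda>w. matrix_inv (M w) $ i $ j)"
  unfolding pos_homog_def
proof (intro allI impI)
  fix t :: real and w :: "real^'k"
  assume "t > 0" "w \<noteq> 0"
  then have "M (t *\<^sub>R w) = M w"
    using pos_homogD[OF assms] by (simp add: vec_eq_iff)
  then show "matrix_inv (M (t *\<^sub>R w)) $ i $ j = t powi 0 * matrix_inv (M w) $ i $ j"
    by simp
qed

section \<open>Products of functions on the two factors\<close>

lemma sum_UNIV_Plus:
  fixes h :: "'a::finite + 'b::finite \<Rightarrow> 'c::comm_monoid_add"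
  shows "(\<Sum>k\<in>UNIV. h k) = (\<Sum>i\<in>UNIV. h (Inl i)) + (\<Sum>j\<in>UNIV. h (Inr j))"
  unfolding UNIV_Plus_UNIV[symmetric] by (subst sum.Plus) (simp_all add: o_def)

lemma bounded_linear_fst_part: "bounded_linear (fst_part :: real^('m::finite + 'n::finite) \<Rightarrow> real^'m)"
  unfolding linear_conv_bounded_linear[symmetric]
  by (rule linearI) (simp_all add: fst_part_def vec_eq_iff)

lemma bounded_linear_snd_part: "bounded_linear (snd_part :: real^('m::finite + 'n::finite) \<Rightarrow> real^'n)"
  unfolding linear_conv_bounded_linear[symmetric]
  by (rule linearI) (simp_all add: snd_part_def vec_eq_iff)

lemma fst_part_axis [simp]: "fst_part (axis (Inl i) 1) = axis i 1" "fst_part (axis (Inr j) 1) = 0"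
  by (simp_all add: fst_part_def axis_def vec_eq_iff)

lemma snd_part_axis [simp]: "snd_part (axis (Inr j) 1) = axis j 1" "snd_part (axis (Inl i) 1) = 0"
  by (simp_all add: snd_part_def axis_def vec_eq_iff)

definition slit :: "(real^('m::finite + 'n::finite)) set" where
  "slit = {y. fst_part y \<noteq> 0 \<and> snd_part y \<noteq> 0}"

lemma open_slit: "open (slit :: (real^('m::finite + 'n::finite)) set)"
proof -
  have "open ((fst_part :: real^('m + 'n) \<Rightarrow> real^'m) -` (- {0}) \<inter> snd_part -` (- {0}))"
    by (intro open_Int open_vimage open_compl_zero linear_continuous_on
        bounded_linear_fst_part bounded_linear_snd_part)
  moreover have "(slit :: (real^('m + 'n)) set) = fst_part -` (- {0}) \<inter> snd_part -` (- {0})"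
    by (auto simp: slit_def)
  ultimately show ?thesis by simp
qed

text \<open>Functions of \<open>y = (y\<^sub>1, y\<^sub>2)\<close> with separated variables. They are handled as pairs of factors
  because a partial derivative then acts on just one factor, and because a constant
  factor shows which derivatives of the product vanish.\<close>

definition tensor ::
    "(real^'m::finite \<Rightarrow> real) \<Rightarrow> (real^'n::finite \<Rightarrow> real) \<Rightarrow> real^('m + 'n) \<Rightarrow> real" where
  "tensor u v y = u (fst_part y) * v (snd_part y)"

definition pderiv_left :: "'m + 'n \<Rightarrow> (real^'m::finite \<Rightarrow> real) \<Rightarrow> real^'m \<Rightarrow> real" where
  "pderiv_left \<alpha> u = (case \<alpha> of Inl i \<Rightarrow> pderiv_at i u | Inr j \<Rightarrow> u)"

definition pderiv_right :: "'m + 'n \<Rightarrow> (real^'n::finite \<Rightarrow> real) \<Rightarrow> real^'n \<Rightarrow> real" where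
  "pderiv_right \<alpha> v = (case \<alpha> of Inl i \<Rightarrow> v | Inr j \<Rightarrow> pderiv_at j v)"

lemma pderiv_left_simps [simp]:
  "pderiv_left (Inl i) u = pderiv_at i u" "pderiv_left (Inr j) u = u"
  by (simp_all add: pderiv_left_def)

lemma pderiv_right_simps [simp]:
  "pderiv_right (Inl i) v = v" "pderiv_right (Inr j) v = pderiv_at j v"
  by (simp_all add: pderiv_right_def)

lemma smooth_on_pderiv_left: "smooth_on S u \<Longrightarrow> smooth_on S (pderiv_left \<alpha> u)"
  by (cases \<alpha>) (simp_all add: smooth_on_pderiv_at)

lemma smooth_on_pderiv_right: "smooth_on S v \<Longrightarrow> smooth_on S (pderiv_right \<alpha> v)"
  by (cases \<alpha>) (simp_all add: smooth_on_pderiv_at)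

lemma tensor_has_derivative:
  assumes "smooth_on (-{0}) u" "smooth_on (-{0}) v" "y \<in> slit"
  shows "(tensor u v has_derivative
      (\<lambda>h. u (fst_part y) * frechet_derivative v (at (snd_part y)) (snd_part h)
         + frechet_derivative u (at (fst_part y)) (fst_part h) * v (snd_part y))) (at y)"
  unfolding tensor_def[abs_def]
  by (intro has_derivative_mult
      has_derivative_compose[OF bounded_linear_imp_has_derivative[OF bounded_linear_fst_part]]
      has_derivative_compose[OF bounded_linear_imp_has_derivative[OF bounded_linear_snd_part]]
      smooth_on_has_derivative[OF assms(1)] smooth_on_has_derivative[OF assms(2)])
    (use assms(3) in \<open>simp_all add: slit_def\<close>)

text \<open>Two products are what the square of the metric, its base derivatives and the spray coefficients
  consist of. The conclusion has the form of the hypothesis on \<open>h\<close>, so that the rule can be iterated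
  to compute second and third derivatives.\<close>

lemma pderiv_at_tensor_sum:
  assumes sm: "smooth_on (-{0}) u" "smooth_on (-{0}) v" "smooth_on (-{0}) u'" "smooth_on (-{0}) v'"
    and h: "\<And>z. z \<in> slit \<Longrightarrow> h z = tensor u v z + tensor u' v' z" and y: "y \<in> slit"
  shows "pderiv_at \<alpha> h y = tensor (pderiv_left \<alpha> u) (pderiv_right \<alpha> v) y
           + tensor (pderiv_left \<alpha> u') (pderiv_right \<alpha> v') y"
proof -
  \<comment> \<open>The coordinate directions of one factor have zero component in the other.\<close>
  have z: "frechet_derivative w (at z) 0 = 0" if "smooth_on (-{0}) w" "z \<noteq> 0"
    for w :: "real^'k::finite \<Rightarrow> real" and z
    using linear_0[OF has_derivative_linear[OF smooth_on_has_derivative[OF that(1)]]] that(2) by simp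
  have "pderiv_at \<alpha> h y = pderiv_at \<alpha> (\<lambda>z. tensor u v z + tensor u' v' z) y"
    by (rule pderiv_at_cong_open[OF open_slit y h])
  also have "\<dots> = tensor (pderiv_left \<alpha> u) (pderiv_right \<alpha> v) y
           + tensor (pderiv_left \<alpha> u') (pderiv_right \<alpha> v') y"
    by (subst pderiv_at_eqI[OF has_derivative_add[OF tensor_has_derivative[OF sm(1,2) y]
            tensor_has_derivative[OF sm(3,4) y]]], cases \<alpha>)
      (use y in \<open>simp_all add: tensor_def pderiv_at_def z sm slit_def\<close>)
  finally show ?thesis .
qed

lemma pderiv_at_tensor:
  assumes "smooth_on (-{0}) u" "smooth_on (-{0}) v"
    and "\<And>z. z \<in> slit \<Longrightarrow> h z = tensor u v z" and "y \<in> slit"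
  shows "pderiv_at \<alpha> h y = tensor (pderiv_left \<alpha> u) (pderiv_right \<alpha> v) y"
  using pderiv_at_tensor_sum[OF assms(1,2) smooth_on_const[of _ 0] smooth_on_const[of _ 0], of h y \<alpha>] assms(3,4)
  by (cases \<alpha>) (simp_all add: tensor_def)

section \<open>Scaling the second fibre component\<close>

definition scale_snd :: "real \<Rightarrow> real^('m::finite + 'n::finite) \<Rightarrow> real^('m + 'n)" where
  "scale_snd t y = (\<chi> \<alpha>. case \<alpha> of Inl i \<Rightarrow> y $ Inl i | Inr j \<Rightarrow> t * y $ Inr j)"

lemma scale_snd_parts [simp]:
  "fst_part (scale_snd t y) = fst_part y" "snd_part (scale_snd t y) = t *\<^sub>R snd_part y"
  by (simp_all add: scale_snd_def fst_part_def snd_part_def vec_eq_iff)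

lemma scale_snd_nth [simp]:
  "scale_snd t y $ Inl i = y $ Inl i" "scale_snd t y $ Inr j = t * y $ Inr j"
  by (simp_all add: scale_snd_def)

lemma scale_snd_slit: "t > 0 \<Longrightarrow> y \<in> slit \<Longrightarrow> scale_snd t y \<in> slit"
  by (simp add: slit_def)

lemma tensor_scale_snd:
  assumes "pos_homog k v" "t > 0" "y \<in> slit"
  shows "tensor u v (scale_snd t y) = t powi k * tensor u v y"
  using pos_homogD[OF assms(1,2)] assms(3) by (simp add: tensor_def slit_def)

text \<open>The weight of an index under \<^const>\<open>scale_snd\<close>: the degree by which a derivative in the direction of this index
  lowers the degree of homogeneity in \<open>y\<^sub>2\<close>.\<close>

definition fibre_deg :: "'m + 'n \<Rightarrow> int" where
  "fibre_deg \<alpha> = (case \<alpha> of Inl i \<Rightarrow> 0 | Inr j \<Rightarrow> 1)"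

lemma fibre_deg_simps [simp]: "fibre_deg (Inl i) = 0" "fibre_deg (Inr j) = 1"
  by (simp_all add: fibre_deg_def)

lemma pos_homog_pderiv_right:
  assumes "smooth_on (-{0}) v" "pos_homog k v"
  shows "pos_homog (k - fibre_deg \<alpha>) (pderiv_right \<alpha> v)"
  using assms by (cases \<alpha>) (simp_all add: pos_homog_pderiv_at)

section \<open>Quadratic polynomials and the square root\<close>

definition quadratic_on_pos :: "(real \<Rightarrow> real) \<Rightarrow> bool" where
  "quadratic_on_pos q \<longleftrightarrow> (\<exists>a b c. \<forall>t>0. q t = a + b * t + c * t\<^sup>2)"

lemma quadratic_on_pos_add:
  assumes "quadratic_on_pos p" "quadratic_on_pos q"
  shows "quadratic_on_pos (\<lambda>t. p t + q t)"
proof -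
  obtain a b c where "\<forall>t>0. p t = a + b * t + c * t\<^sup>2"
    using assms(1) unfolding quadratic_on_pos_def by blast
  moreover obtain a' b' c' where "\<forall>t>0. q t = a' + b' * t + c' * t\<^sup>2"
    using assms(2) unfolding quadratic_on_pos_def by blast
  ultimately have "\<forall>t>0. p t + q t = (a + a') + (b + b') * t + (c + c') * t\<^sup>2"
    by (simp add: algebra_simps)
  then show ?thesis
    unfolding quadratic_on_pos_def by blast
qed

lemma quadratic_on_pos_cmult:
  assumes "quadratic_on_pos q"
  shows "quadratic_on_pos (\<lambda>t. r * q t)"
proof -
  obtain a b c where "\<forall>t>0. q t = a + b * t + c * t\<^sup>2"
    using assms unfolding quadratic_on_pos_def by blast
  then have "\<forall>t>0. r * q t = r * a + r * b * t + r * c * t\<^sup>2"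
    by (simp add: algebra_simps)
  then show ?thesis
    unfolding quadratic_on_pos_def by blast
qed

lemma quadratic_on_pos_monomial:
  assumes "\<And>t. t > 0 \<Longrightarrow> q t = t powi k * a" "k \<in> {0, 1, 2}"
  shows "quadratic_on_pos q"
proof -
  have "\<forall>t>0. q t = (if k = 0 then a else 0) + (if k = 1 then a else 0) * t + (if k = 2 then a else 0) * t\<^sup>2"
    using assms by (auto simp: power_int_def)
  then show ?thesis
    unfolding quadratic_on_pos_def by blast
qed

lemma quadratic_on_pos_zero: "(\<And>t. t > 0 \<Longrightarrow> q t = 0) \<Longrightarrow> quadratic_on_pos q"
  by (rule quadratic_on_pos_monomial[of q 0 0]) simp_all

lemma quadratic_on_pos_sum:
  "(\<And>i. i \<in> I \<Longrightarrow> quadratic_on_pos (q i)) \<Longrightarrow> quadratic_on_pos (\<lambda>t. \<Sum>i\<in>I. q i t)"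
  by (induction I rule: infinite_finite_induct)
    (simp_all add: quadratic_on_pos_zero quadratic_on_pos_add)

text \<open>Five values determine a polynomial of degree four; the values at 1, 2, 3, 4, 5 form a
  linear system with invertible (Vandermonde) matrix.\<close>

lemma quartic_coeffs_zero:
  fixes p0 p1 p2 p3 p4 :: real
  assumes "\<And>t. t > 0 \<Longrightarrow> p0 + p1 * t + p2 * t^2 + p3 * t^3 + p4 * t^4 = 0"
  shows "p0 = 0" "p1 = 0" "p2 = 0" "p3 = 0" "p4 = 0"
  using assms[of 1] assms[of 2] assms[of 3] assms[of 4] assms[of 5] by simp_all

text \<open>If \<open>q = - k sqrt (a + b t\<^sup>2)\<close>, then \<open>q\<^sup>2 = k\<^sup>2 a + k\<^sup>2 b t\<^sup>2\<close>. For \<open>q = A + B t + C t\<^sup>2\<close> this forces \<open>C = 0\<close>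
  and \<open>A B = 0\<close>, so one of \<open>A\<^sup>2 = k\<^sup>2 a\<close> and \<open>B\<^sup>2 = k\<^sup>2 b\<close> vanishes. Both \<open>a > 0\<close> and \<open>b > 0\<close> matter:
  otherwise the square root is itself a polynomial.\<close>

lemma sqrt_not_quadratic:
  assumes "quadratic_on_pos q" "a > 0" "b > 0"
    and eq: "\<And>t. t > 0 \<Longrightarrow> q t + k * sqrt (a + b * t\<^sup>2) = 0"
  shows "k = 0"
proof -
  obtain A B C where q: "\<forall>t>0. q t = A + B * t + C * t\<^sup>2"
    using assms(1) by (auto simp: quadratic_on_pos_def)
  have sq: "(A + B * t + C * t\<^sup>2)\<^sup>2 = k\<^sup>2 * (a + b * t\<^sup>2)" if "t > 0" for t
  proof -
    have "A + B * t + C * t\<^sup>2 = - k * sqrt (a + b * t\<^sup>2)"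
      using eq[OF that] q that by auto
    then have "(A + B * t + C * t\<^sup>2)\<^sup>2 = k\<^sup>2 * (sqrt (a + b * t\<^sup>2))\<^sup>2"
      by (simp add: power_mult_distrib)
    also have "(sqrt (a + b * t\<^sup>2))\<^sup>2 = a + b * t\<^sup>2"
      using assms(2,3) by (intro real_sqrt_pow2) simp
    finally show ?thesis .
  qed
  have "(A\<^sup>2 - k\<^sup>2 * a) + 2 * (A * B) * t + (B\<^sup>2 + 2 * (A * C) - k\<^sup>2 * b) * t^2 + 2 * (B * C) * t^3
      + C\<^sup>2 * t^4 = 0" if "t > 0" for t
    using sq[OF that] by (simp add: algebra_simps power2_eq_square power3_eq_cube power4_eq_xxxx)
  note c = quartic_coeffs_zero[OF this]
  then have "k\<^sup>2 * a = 0 \<or> k\<^sup>2 * b = 0"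
    by auto
  then show "k = 0"
    using assms(2,3) by auto
qed

section \<open>Curvature of a twisted product along one fibre\<close>

text \<open>The situation over one point \<open>x\<close>, in coordinates: \<open>e1\<close>, \<open>e2\<close> are the squares of the two metrics on the
  tangent spaces at \<open>x\<close>, \<open>p1\<close>, \<open>p2\<close> their partial derivatives in the base directions, \<open>s\<close> is the
  value of \<open>f\<^sup>2\<close> at \<open>x\<close> and \<open>d\<close> its gradient. The curvature quantities at \<open>x\<close> involve the metric at other
  base points only through the first derivatives \<open>p1\<close>, \<open>p2\<close>, \<open>d\<close>, so that manifolds and charts
  need not be mentioned.\<close>

locale twisted_fibre =
  fixes F :: "real^('m::finite + 'n::finite) \<Rightarrow> real^('m + 'n) \<Rightarrow> real"
    and x :: "real^('m + 'n)"
    and e1 :: "real^'m \<Rightarrow> real" and e2 :: "real^'n \<Rightarrow> real"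
    and p1 :: "'m \<Rightarrow> real^'m \<Rightarrow> real" and p2 :: "'n \<Rightarrow> real^'n \<Rightarrow> real"
    and s :: real and d :: "'m + 'n \<Rightarrow> real"
  assumes F_eq: "F x y = sqrt (e1 (fst_part y) + s * e2 (snd_part y))"
    and e1_nonneg: "e1 v \<ge> 0" and e2_nonneg: "e2 w \<ge> 0" and s_pos: "s > 0"
    and dx_left: "y \<in> slit \<Longrightarrow>
      pderiv_at (Inl q) (\<lambda>u. (F u y)\<^sup>2) x = p1 q (fst_part y) + d (Inl q) * e2 (snd_part y)"
    and dx_right: "y \<in> slit \<Longrightarrow>
      pderiv_at (Inr r) (\<lambda>u. (F u y)\<^sup>2) x = d (Inr r) * e2 (snd_part y) + s * p2 r (snd_part y)"
    and smooth: "smooth_on (-{0}) e1" "smooth_on (-{0}) e2"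
      "smooth_on (-{0}) (p1 q)" "smooth_on (-{0}) (p2 r)"
    and homog: "pos_homog 2 e1" "pos_homog 2 e2" "pos_homog 2 (p2 r)"
    and pos_def1: "v \<noteq> 0 \<Longrightarrow> v' \<noteq> 0 \<Longrightarrow> v' \<bullet> (half_hessian e1 v *v v') > 0"
    and pos_def2: "w \<noteq> 0 \<Longrightarrow> w' \<noteq> 0 \<Longrightarrow> w' \<bullet> (half_hessian e2 w *v w') > 0"
begin

text \<open>The fundamental tensor is block diagonal with blocks \<open>g\<^sub>1(y\<^sub>1)\<close> and \<open>s g\<^sub>2(y\<^sub>2)\<close>. Every entry is written as a
  single product: the factor \<open>0\<close> of the off-diagonal blocks is put on the left and the right
  factor is \<open>1\<close> by default, so that all right factors have degree 0 in \<open>y\<^sub>2\<close>. The same convention is used for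
  the inverse.\<close>

definition metric_left :: "'m + 'n \<Rightarrow> 'm + 'n \<Rightarrow> real^'m \<Rightarrow> real" where
  "metric_left \<alpha> \<beta> = (case (\<alpha>, \<beta>) of
     (Inl i, Inl j) \<Rightarrow> (\<lambda>v. half_hessian e1 v $ i $ j) | (Inr a, Inr b) \<Rightarrow> (\<lambda>v. s) | _ \<Rightarrow> (\<lambda>v. 0))"

definition metric_right :: "'m + 'n \<Rightarrow> 'm + 'n \<Rightarrow> real^'n \<Rightarrow> real" where
  "metric_right \<alpha> \<beta> = (case (\<alpha>, \<beta>) of
     (Inr a, Inr b) \<Rightarrow> (\<lambda>w. half_hessian e2 w $ a $ b) | _ \<Rightarrow> (\<lambda>w. 1))"

definition inv_metric_left :: "'m + 'n \<Rightarrow> 'm + 'n \<Rightarrow> real^'m \<Rightarrow> real" where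
  "inv_metric_left \<alpha> \<beta> = (case (\<alpha>, \<beta>) of
     (Inl i, Inl j) \<Rightarrow> (\<lambda>v. matrix_inv (half_hessian e1 v) $ i $ j)
   | (Inr a, Inr b) \<Rightarrow> (\<lambda>v. inverse s) | _ \<Rightarrow> (\<lambda>v. 0))"

definition inv_metric_right :: "'m + 'n \<Rightarrow> 'm + 'n \<Rightarrow> real^'n \<Rightarrow> real" where
  "inv_metric_right \<alpha> \<beta> = (case (\<alpha>, \<beta>) of
     (Inr a, Inr b) \<Rightarrow> (\<lambda>w. matrix_inv (half_hessian e2 w) $ a $ b) | _ \<Rightarrow> (\<lambda>w. 1))"

lemma F_sq: "(F x y)\<^sup>2 = e1 (fst_part y) + s * e2 (snd_part y)"
  unfolding F_eq using e1_nonneg e2_nonneg s_pos by (intro real_sqrt_pow2) (simp add: add_nonneg_nonneg)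

lemma smooth_metric: "smooth_on (-{0}) (metric_left \<alpha> \<beta>)" "smooth_on (-{0}) (metric_right \<alpha> \<beta>)"
  by (cases \<alpha>; cases \<beta>; simp add: metric_left_def metric_right_def
      smooth_on_const smooth_on_half_hessian[OF open_compl_zero smooth(1)]
      smooth_on_half_hessian[OF open_compl_zero smooth(2)])+

lemma pos_homog_metric: "pos_homog 0 (metric_right \<alpha> \<beta>)" "pos_homog 0 (inv_metric_right \<alpha> \<beta>)"
  by (cases \<alpha>; cases \<beta>; simp add: metric_right_def inv_metric_right_def
      pos_homog_const pos_homog_matrix_inv pos_homog_half_hessian[OF smooth(2) homog(2)])+

lemma fund_tensor_eq:
  assumes "y \<in> slit"
  shows "fund_tensor F x y $ \<alpha> $ \<beta> = tensor (metric_left \<alpha> \<beta>) (metric_right \<alpha> \<beta>) y"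
proof -
  have 1: "pderiv_at \<alpha> (\<lambda>w. (F x w)\<^sup>2) z
      = tensor (pderiv_left \<alpha> e1) (pderiv_right \<alpha> (\<lambda>w. 1)) z
      + tensor (pderiv_left \<alpha> (\<lambda>v. s)) (pderiv_right \<alpha> e2) z" if "z \<in> slit" for z
    by (rule pderiv_at_tensor_sum[OF smooth(1) smooth_on_const smooth_on_const smooth(2) _ that])
      (simp add: F_sq tensor_def)
  have "pderiv_at \<beta> (\<lambda>v. pderiv_at \<alpha> (\<lambda>w. (F x w)\<^sup>2) v) y
      = tensor (pderiv_left \<beta> (pderiv_left \<alpha> e1)) (pderiv_right \<beta> (pderiv_right \<alpha> (\<lambda>w. 1))) y
      + tensor (pderiv_left \<beta> (pderiv_left \<alpha> (\<lambda>v. s))) (pderiv_right \<beta> (pderiv_right \<alpha> e2)) y"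
    by (rule pderiv_at_tensor_sum[OF _ _ _ _ 1 assms])
      (intro smooth_on_pderiv_left smooth_on_pderiv_right smooth smooth_on_const)+
  then show ?thesis
    by (cases \<alpha>; cases \<beta>)
      (simp_all add: fund_tensor_def tensor_def metric_left_def metric_right_def half_hessian_def)
qed

lemma det_half_hessian: "v \<noteq> 0 \<Longrightarrow> det (half_hessian e1 v) \<noteq> 0"
  "w \<noteq> 0 \<Longrightarrow> det (half_hessian e2 w) \<noteq> 0"
  using pos_def1 pos_def2 by (intro pos_def_det_nonzero; simp)+

lemma fund_inv_eq:
  assumes "y \<in> slit"
  shows "fund_inv F x y $ \<alpha> $ \<beta> = tensor (inv_metric_left \<alpha> \<beta>) (inv_metric_right \<alpha> \<beta>) y"
proof -
  define B where "B = (\<chi> \<alpha> \<beta>. tensor (inv_metric_left \<alpha> \<beta>) (inv_metric_right \<alpha> \<beta>) y)"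
  let ?A = "fund_tensor F x y"
  have nz: "fst_part y \<noteq> 0" "snd_part y \<noteq> 0"
    using assms by (auto simp: slit_def)
  note inv1 = matrix_inv_inverse[OF det_half_hessian(1)[OF nz(1)], unfolded vec_eq_iff, rule_format]
  note inv2 = matrix_inv_inverse[OF det_half_hessian(2)[OF nz(2)], unfolded vec_eq_iff, rule_format]
  \<comment> \<open>In this form the cancellation of \<open>s\<close> leaves the sums of the two inverse relations intact.\<close>
  have s_cancel: "s * a * (inverse s * b) = a * b" "inverse s * a * (s * b) = a * b" for a b :: real
    using s_pos by simp_all
  have "(?A ** B) $ \<alpha> $ \<beta> = mat 1 $ \<alpha> $ \<beta>" for \<alpha> \<beta>
    using inv1(1) inv2(1)
    by (cases \<alpha>; cases \<beta>) (simp_all add: matrix_matrix_mult_def sum_UNIV_Plus fund_tensor_eq[OF assms]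
        B_def tensor_def metric_left_def metric_right_def inv_metric_left_def inv_metric_right_def
        mat_def s_cancel)
  moreover have "(B ** ?A) $ \<alpha> $ \<beta> = mat 1 $ \<alpha> $ \<beta>" for \<alpha> \<beta>
    using inv1(2) inv2(2)
    by (cases \<alpha>; cases \<beta>) (simp_all add: matrix_matrix_mult_def sum_UNIV_Plus fund_tensor_eq[OF assms]
        B_def tensor_def metric_left_def metric_right_def inv_metric_left_def inv_metric_right_def
        mat_def s_cancel)
  ultimately have "matrix_inv ?A = B"
    by (intro matrix_inv_eqI) (simp_all add: vec_eq_iff)
  then show ?thesis
    by (simp add: fund_inv_def B_def)
qed

lemma fund_inv_scale_snd:
  assumes "t > 0" "y \<in> slit"
  shows "fund_inv F x (scale_snd t y) $ \<alpha> $ \<beta> = fund_inv F x y $ \<alpha> $ \<beta>"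
  using tensor_scale_snd[OF pos_homog_metric(2) assms]
  by (simp add: fund_inv_eq scale_snd_slit assms)

lemma fund_inv_mixed:
  assumes "y \<in> slit" "fibre_deg \<alpha> \<noteq> fibre_deg \<beta>"
  shows "fund_inv F x y $ \<alpha> $ \<beta> = 0"
  using assms(2) by (cases \<alpha>; cases \<beta>) (simp_all add: fund_inv_eq[OF assms(1)] tensor_def inv_metric_left_def)

lemma lower_y_scale_snd:
  assumes "t > 0" "y \<in> slit"
  shows "lower_y F x (scale_snd t y) \<kappa> = t powi fibre_deg \<kappa> * lower_y F x y \<kappa>"
proof -
  have "fund_tensor F x (scale_snd t y) $ \<kappa> $ \<mu> * scale_snd t y $ \<mu>
      = t powi fibre_deg \<kappa> * (fund_tensor F x y $ \<kappa> $ \<mu> * y $ \<mu>)" for \<mu>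
    using tensor_scale_snd[OF pos_homog_metric(1) assms]
    by (cases \<kappa>; cases \<mu>)
      (simp_all add: fund_tensor_eq scale_snd_slit assms, simp_all add: tensor_def metric_left_def)
  then show ?thesis
    by (simp add: lower_y_def sum_distrib_left)
qed

text \<open>The factors of the spray coefficients
  \<open>G\<^sup>l = a\<^sub>l(y\<^sub>1) 1 + U\<^sub>l(y\<^sub>1) e2(y\<^sub>2)\<close> and \<open>G\<^sup>c = 1 P\<^sub>c(y\<^sub>2) + q(y\<^sub>1) Q\<^sub>c(y\<^sub>2)\<close>: the suffix 0 marks the product that depends
  on one factor alone, the suffix 1 the one that mixes the factors. Here \<open>a\<close> is the spray of the first
  metric, \<open>P\<close> is the spray of \<open>f F\<^sub>2\<close> with \<open>x\<^sub>1\<close> held fixed, and the mixed terms come from the derivatives of \<open>f\<^sup>2\<close> in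
  the directions of the first factor.\<close>

definition spray_left0 :: "'m + 'n \<Rightarrow> real^'m \<Rightarrow> real" where
  "spray_left0 \<kappa> = (case \<kappa> of
     Inl l \<Rightarrow> (\<lambda>v. 1/4 * (\<Sum>p\<in>UNIV. matrix_inv (half_hessian e1 v) $ l $ p *
       ((\<Sum>q\<in>UNIV. pderiv_at p (p1 q) v * v $ q) - p1 p v)))
   | Inr c \<Rightarrow> (\<lambda>v. 1))"

definition spray_right0 :: "'m + 'n \<Rightarrow> real^'n \<Rightarrow> real" where
  "spray_right0 \<kappa> = (case \<kappa> of
     Inl l \<Rightarrow> (\<lambda>w. 1)
   | Inr c \<Rightarrow> (\<lambda>w. 1/4 * (\<Sum>p\<in>UNIV. inverse s * matrix_inv (half_hessian e2 w) $ c $ p *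
       ((\<Sum>q\<in>UNIV. (d (Inr q) * pderiv_at p e2 w + s * pderiv_at p (p2 q) w) * w $ q)
        - (d (Inr p) * e2 w + s * p2 p w)))))"

definition spray_left1 :: "'m + 'n \<Rightarrow> real^'m \<Rightarrow> real" where
  "spray_left1 \<kappa> = (case \<kappa> of
     Inl l \<Rightarrow> (\<lambda>v. (- 1/4) * (\<Sum>p\<in>UNIV. matrix_inv (half_hessian e1 v) $ l $ p * d (Inl p)))
   | Inr c \<Rightarrow> (\<lambda>v. \<Sum>q\<in>UNIV. d (Inl q) * v $ q))"

definition spray_right1 :: "'m + 'n \<Rightarrow> real^'n \<Rightarrow> real" where
  "spray_right1 \<kappa> = (case \<kappa> of
     Inl l \<Rightarrow> e2
   | Inr c \<Rightarrow> (\<lambda>w. 1/4 * (\<Sum>p\<in>UNIV. inverse s * matrix_inv (half_hessian e2 w) $ c $ p * pderiv_at p e2 w)))"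

lemma smooth_inv:
  "smooth_on (-{0}) (\<lambda>v. matrix_inv (half_hessian e1 v) $ i $ j)"
  "smooth_on (-{0}) (\<lambda>w. matrix_inv (half_hessian e2 w) $ a $ b)"
  by (rule smooth_on_matrix_inv[OF open_compl_zero],
      rule smooth_on_half_hessian[OF open_compl_zero smooth(1)], simp add: det_half_hessian)
    (rule smooth_on_matrix_inv[OF open_compl_zero],
      rule smooth_on_half_hessian[OF open_compl_zero smooth(2)], simp add: det_half_hessian)

lemma smooth_spray:
  "smooth_on (-{0}) (spray_left0 \<kappa>)" "smooth_on (-{0}) (spray_right0 \<kappa>)"
  "smooth_on (-{0}) (spray_left1 \<kappa>)" "smooth_on (-{0}) (spray_right1 \<kappa>)"
  unfolding spray_left0_def spray_right0_def spray_left1_def spray_right1_def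
  by (cases \<kappa>; simp only: sum.case;
      intro smooth_on_mult smooth_on_sum smooth_on_diff smooth_on_add open_compl_zero smooth_inv
        smooth smooth_on_pderiv_at smooth_on_nth smooth_on_const)+

lemma pos_homog_spray:
  "pos_homog (2 * fibre_deg \<kappa>) (spray_right0 \<kappa>)" "pos_homog (2 - fibre_deg \<kappa>) (spray_right1 \<kappa>)"
proof -
  note inv = pos_homog_matrix_inv[OF pos_homog_half_hessian[OF smooth(2) homog(2)]]
  have de: "pos_homog 1 (pderiv_at p e2)" "pos_homog 1 (pderiv_at p (p2 q))" for p q
    using pos_homog_pderiv_at[OF smooth(2) homog(2)] pos_homog_pderiv_at[OF smooth(4) homog(3)]
    by simp_all
  show "pos_homog (2 * fibre_deg \<kappa>) (spray_right0 \<kappa>)"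
  proof (cases \<kappa>)
    case (Inr c)
    have "pos_homog 2 (\<lambda>w. (\<Sum>q\<in>UNIV. (d (Inr q) * pderiv_at p e2 w + s * pderiv_at p (p2 q) w) * w $ q)
        - (d (Inr p) * e2 w + s * p2 p w))" for p
      by (intro pos_homog_diff pos_homog_sum pos_homog_add pos_homog_cmult homog
          pos_homog_mult[OF pos_homog_add[OF pos_homog_cmult[OF de(1)] pos_homog_cmult[OF de(2)]]
            pos_homog_nth]) simp
    then show ?thesis
      unfolding Inr spray_right0_def sum.case
      by (intro pos_homog_cmult pos_homog_sum pos_homog_mult[OF pos_homog_cmult[OF inv]]) simp_all
  qed (simp add: spray_right0_def pos_homog_const)
  show "pos_homog (2 - fibre_deg \<kappa>) (spray_right1 \<kappa>)"
  proof (cases \<kappa>)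
    case (Inr c)
    then show ?thesis
      unfolding Inr spray_right1_def sum.case
      by (intro pos_homog_cmult pos_homog_sum pos_homog_mult[OF pos_homog_cmult[OF inv] de(1)]) simp_all
  qed (simp add: spray_right1_def homog)
qed

lemma spray_eq:
  assumes y: "y \<in> slit"
  shows "spray F x y \<kappa> = tensor (spray_left0 \<kappa>) (spray_right0 \<kappa>) y
           + tensor (spray_left1 \<kappa>) (spray_right1 \<kappa>) y"
proof -
  have L: "pderiv_at \<alpha> (\<lambda>w. pderiv_at (Inl q) (\<lambda>u. (F u w)\<^sup>2) x) y
      = tensor (pderiv_left \<alpha> (p1 q)) (pderiv_right \<alpha> (\<lambda>w. 1)) y
      + tensor (pderiv_left \<alpha> (\<lambda>v. d (Inl q))) (pderiv_right \<alpha> e2) y" for \<alpha> q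
    by (rule pderiv_at_tensor_sum[OF smooth(3) smooth_on_const smooth_on_const smooth(2) _ y])
      (simp add: dx_left tensor_def)
  have R: "pderiv_at \<alpha> (\<lambda>w. pderiv_at (Inr r) (\<lambda>u. (F u w)\<^sup>2) x) y
      = tensor (pderiv_left \<alpha> (\<lambda>v. d (Inr r))) (pderiv_right \<alpha> e2) y
      + tensor (pderiv_left \<alpha> (\<lambda>v. s)) (pderiv_right \<alpha> (p2 r)) y" for \<alpha> r
    by (rule pderiv_at_tensor_sum[OF smooth_on_const smooth(2) smooth_on_const smooth(4) _ y])
      (simp add: dx_right tensor_def)
  have nth: "y $ Inl i = fst_part y $ i" "y $ Inr j = snd_part y $ j" for i j
    by (simp_all add: fst_part_def snd_part_def)
  show ?thesis
  proof (cases \<kappa>)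
    case (Inl l)
    show ?thesis
      unfolding Inl spray_def
      by (simp add: sum_UNIV_Plus L R nth fund_inv_eq[OF y] tensor_def inv_metric_left_def inv_metric_right_def
          spray_left0_def spray_right0_def spray_left1_def spray_right1_def dx_left[OF y] dx_right[OF y]
          algebra_simps sum.distrib sum_subtractf sum_negf sum_distrib_left sum_distrib_right sum_divide_distrib
          add_divide_distrib diff_divide_distrib)
  next
    case (Inr c)
    show ?thesis
      unfolding Inr spray_def
      by (simp add: sum_UNIV_Plus L R nth fund_inv_eq[OF y] tensor_def inv_metric_left_def inv_metric_right_def
          spray_left0_def spray_right0_def spray_left1_def spray_right1_def dx_left[OF y] dx_right[OF y]
          algebra_simps sum.distrib sum_subtractf sum_negf sum_distrib_left sum_distrib_right sum_divide_distrib
          add_divide_distrib diff_divide_distrib)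
  qed
qed

lemma berwald_eq:
  assumes y: "y \<in> slit"
  shows "berwald F x y \<alpha> \<kappa> \<beta> \<gamma> =
      tensor (pderiv_left \<alpha> (pderiv_left \<beta> (pderiv_left \<gamma> (spray_left0 \<kappa>))))
        (pderiv_right \<alpha> (pderiv_right \<beta> (pderiv_right \<gamma> (spray_right0 \<kappa>)))) y
    + tensor (pderiv_left \<alpha> (pderiv_left \<beta> (pderiv_left \<gamma> (spray_left1 \<kappa>))))
        (pderiv_right \<alpha> (pderiv_right \<beta> (pderiv_right \<gamma> (spray_right1 \<kappa>)))) y"
  unfolding berwald_def
  by (intro pderiv_at_tensor_sum smooth_on_pderiv_left smooth_on_pderiv_right smooth_spray spray_eq y)

text \<open>The degree count. If \<open>\<beta>\<close> and \<open>\<gamma>\<close> belong to different factors, the inverse metric vanishes. Otherwise, with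
  \<open>w\<close> for \<^const>\<open>fibre_deg\<close>, the lower index vector contributes the degree \<open>w \<kappa>\<close>, the prefactor \<open>w \<alpha>\<close>, and the third derivative
  lowers the degree of the spray coefficient by \<open>w \<alpha> + w \<beta> + w \<gamma>\<close>. The unmixed product has degree
  \<open>2 w \<kappa>\<close>, and is killed unless all three derivatives are taken in the factor of \<open>\<kappa>\<close>; the total is then 0 or 1.
  The mixed product has degree \<open>2 - w \<kappa>\<close>, which makes the total \<open>2 - 2 w \<beta>\<close>; it is 0 or 2.\<close>

lemma quadratic_landsberg_term:
  assumes y: "y \<in> slit"
  shows "quadratic_on_pos (\<lambda>t. t powi fibre_deg \<alpha> *
    (lower_y F x (scale_snd t y) \<kappa> * berwald F x (scale_snd t y) \<alpha> \<kappa> \<beta> \<gamma>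
      * fund_inv F x (scale_snd t y) $ \<beta> $ \<gamma>))" (is "quadratic_on_pos ?q")
proof (cases "fibre_deg \<beta> = fibre_deg \<gamma>")
  case False
  then show ?thesis
    by (intro quadratic_on_pos_zero) (simp add: fund_inv_scale_snd[OF _ y] fund_inv_mixed[OF y])
next
  case True
  define L0 L1 R0 R1 where
    "L0 = pderiv_left \<alpha> (pderiv_left \<beta> (pderiv_left \<gamma> (spray_left0 \<kappa>)))" and
    "L1 = pderiv_left \<alpha> (pderiv_left \<beta> (pderiv_left \<gamma> (spray_left1 \<kappa>)))" and
    "R0 = pderiv_right \<alpha> (pderiv_right \<beta> (pderiv_right \<gamma> (spray_right0 \<kappa>)))" and
    "R1 = pderiv_right \<alpha> (pderiv_right \<beta> (pderiv_right \<gamma> (spray_right1 \<kappa>)))"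
  define K where "K = fibre_deg \<alpha> + fibre_deg \<beta> + fibre_deg \<gamma>"
  have h0: "pos_homog (2 * fibre_deg \<kappa> - K) R0"
    using pos_homog_pderiv_right[OF smooth_on_pderiv_right[OF smooth_on_pderiv_right[OF smooth_spray(2)]]
      pos_homog_pderiv_right[OF smooth_on_pderiv_right[OF smooth_spray(2)]
      pos_homog_pderiv_right[OF smooth_spray(2) pos_homog_spray(1)]]]
    by (simp add: R0_def K_def algebra_simps)
  have h1: "pos_homog (2 - fibre_deg \<kappa> - K) R1"
    using pos_homog_pderiv_right[OF smooth_on_pderiv_right[OF smooth_on_pderiv_right[OF smooth_spray(4)]]
      pos_homog_pderiv_right[OF smooth_on_pderiv_right[OF smooth_spray(4)]
      pos_homog_pderiv_right[OF smooth_spray(4) pos_homog_spray(2)]]]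
    by (simp add: R1_def K_def algebra_simps)
  let ?c = "lower_y F x y \<kappa> * fund_inv F x y $ \<beta> $ \<gamma>"
  define q where "q k L R t = t powi (fibre_deg \<alpha> + fibre_deg \<kappa> + k) * (?c * tensor L R y)"
    for k L R and t :: real
  have q_split: "q k L R t = t powi fibre_deg \<alpha> * t powi fibre_deg \<kappa> * t powi k * (?c * tensor L R y)"
    if "t > 0" for k L R t
    using that by (simp add: q_def power_int_add)
  have "?q t = q (2 * fibre_deg \<kappa> - K) L0 R0 t + q (2 - fibre_deg \<kappa> - K) L1 R1 t" if t: "t > 0" for t
    using t
    by (simp add: berwald_eq[OF scale_snd_slit[OF t y]] lower_y_scale_snd[OF t y] fund_inv_scale_snd[OF t y]
        flip: L0_def L1_def R0_def R1_def)
      (simp add: tensor_scale_snd[OF h0 t y] tensor_scale_snd[OF h1 t y] q_split algebra_simps)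
  moreover have "quadratic_on_pos (\<lambda>t. q (2 * fibre_deg \<kappa> - K) L0 R0 t + q (2 - fibre_deg \<kappa> - K) L1 R1 t)"
  proof (rule quadratic_on_pos_add)
    show "quadratic_on_pos (q (2 * fibre_deg \<kappa> - K) L0 R0)"
    proof (cases "tensor L0 R0 y = 0")
      case False
      then have "fibre_deg \<alpha> + fibre_deg \<kappa> + (2 * fibre_deg \<kappa> - K) \<in> {0, 1, 2}"
        by (cases \<alpha>; cases \<beta>; cases \<gamma>; cases \<kappa>)
          (simp_all add: K_def L0_def R0_def spray_left0_def spray_right0_def tensor_def)
      then show ?thesis
        by (intro quadratic_on_pos_monomial) (simp_all only: q_def)
    qed (simp add: quadratic_on_pos_zero q_def)
    show "quadratic_on_pos (q (2 - fibre_deg \<kappa> - K) L1 R1)"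
    proof -
      have "fibre_deg \<alpha> + fibre_deg \<kappa> + (2 - fibre_deg \<kappa> - K) \<in> {0, 1, 2}"
        using True by (cases \<beta>) (simp_all add: K_def)
      then show ?thesis
        by (intro quadratic_on_pos_monomial) (simp_all only: q_def)
    qed
  qed
  ultimately show ?thesis
    unfolding quadratic_on_pos_def by simp
qed

lemma quadratic_mean_landsberg:
  assumes y: "y \<in> slit"
  shows "quadratic_on_pos (\<lambda>t. t powi fibre_deg \<alpha> * mean_landsberg F x (scale_snd t y) \<alpha>)"
proof -
  have eq: "t powi fibre_deg \<alpha> * mean_landsberg F x (scale_snd t y) \<alpha> =
     (\<Sum>\<beta>\<in>UNIV. \<Sum>\<gamma>\<in>UNIV. \<Sum>\<kappa>\<in>UNIV. - (1/2) * (t powi fibre_deg \<alpha> *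
    (lower_y F x (scale_snd t y) \<kappa> * berwald F x (scale_snd t y) \<alpha> \<kappa> \<beta> \<gamma>
      * fund_inv F x (scale_snd t y) $ \<beta> $ \<gamma>)))" for t
    by (simp add: mean_landsberg_def landsberg_def sum_distrib_left sum_distrib_right mult_ac)
  show ?thesis
    unfolding eq
    by (intro quadratic_on_pos_sum quadratic_on_pos_cmult quadratic_landsberg_term y)
qed

text \<open>The inverse metric is block diagonal and the metric entries separate the factors, so \<open>I\<^sub>\<alpha>\<close> is the mean Cartan
  torsion of the factor to which \<open>\<alpha>\<close> belongs; it is homogeneous of degree \<open>-1\<close> in that factor's own variable.\<close>

lemma mean_cartan_scale_snd:
  assumes t: "t > 0" and y: "y \<in> slit"
  shows "t powi fibre_deg \<alpha> * mean_cartan F x (scale_snd t y) \<alpha> = mean_cartan F x y \<alpha>"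
proof -
  have C: "cartan_torsion F x z \<alpha> \<beta> \<gamma>
      = 1/2 * tensor (pderiv_left \<gamma> (metric_left \<alpha> \<beta>)) (pderiv_right \<gamma> (metric_right \<alpha> \<beta>)) z"
    if "z \<in> slit" for z \<alpha> \<beta> \<gamma>
    unfolding cartan_torsion_def
    by (subst pderiv_at_tensor[OF smooth_metric fund_tensor_eq that]) simp_all
  have "t powi fibre_deg \<alpha> * (cartan_torsion F x (scale_snd t y) \<alpha> \<beta> \<gamma>
        * fund_inv F x (scale_snd t y) $ \<beta> $ \<gamma>)
      = cartan_torsion F x y \<alpha> \<beta> \<gamma> * fund_inv F x y $ \<beta> $ \<gamma>" for \<beta> \<gamma>
    using fund_inv_mixed[OF y, of \<beta> \<gamma>] t t[THEN less_imp_neq]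
      tensor_scale_snd[OF pos_homog_pderiv_right[OF smooth_metric(2) pos_homog_metric(1)] t y,
        of "pderiv_left \<gamma> (metric_left \<alpha> \<beta>)" \<gamma> \<alpha> \<beta>]
    by (cases \<alpha>; cases \<beta>; cases \<gamma>)
      (simp_all add: C y scale_snd_slit t fund_inv_scale_snd power_int_minus,
        simp_all add: tensor_def metric_left_def)
  then show ?thesis
    by (simp add: mean_cartan_def sum_distrib_left)
qed

text \<open>The scalar \<open>c\<close> is the same at all points of the fibre, so the hypothesis may be used along the
  whole ray \<open>(y\<^sub>1, t y\<^sub>2)\<close>.\<close>

lemma isotropic_imp_mean_landsberg_zero:
  assumes iso: "\<And>y \<alpha>. y \<in> slit \<Longrightarrow> mean_landsberg F x y \<alpha> + c * F x y * mean_cartan F x y \<alpha> = 0"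
    and y: "y \<in> slit"
  shows "mean_landsberg F x y \<alpha> = 0"
proof -
  have nz: "fst_part y \<noteq> 0" "snd_part y \<noteq> 0"
    using y by (auto simp: slit_def)
  define a b where "a = e1 (fst_part y)" and "b = s * e2 (snd_part y)"
  have "a > 0"
    unfolding a_def by (rule pos_homog_2_positive[OF smooth(1) homog(1) nz(1) pos_def1[OF nz(1)]])
  moreover have "b > 0"
    unfolding b_def using s_pos
    by (intro mult_pos_pos pos_homog_2_positive[OF smooth(2) homog(2) nz(2) pos_def2[OF nz(2)]])
  moreover have "t powi fibre_deg \<alpha> * mean_landsberg F x (scale_snd t y) \<alpha>
      + (c * mean_cartan F x y \<alpha>) * sqrt (a + b * t\<^sup>2) = 0" if t: "t > 0" for t
  proof -
    have "F x (scale_snd t y) = sqrt (a + b * t\<^sup>2)"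
      using pos_homogD[OF homog(2) t nz(2)] by (simp add: F_eq a_def b_def mult_ac)
    then have "t powi fibre_deg \<alpha> * mean_landsberg F x (scale_snd t y) \<alpha>
      + c * sqrt (a + b * t\<^sup>2) * (t powi fibre_deg \<alpha> * mean_cartan F x (scale_snd t y) \<alpha>)
      = t powi fibre_deg \<alpha> * 0"
      unfolding iso[OF scale_snd_slit[OF t y], of \<alpha>, symmetric] by (simp add: algebra_simps)
    then show ?thesis
      by (simp add: mean_cartan_scale_snd[OF t y] mult_ac)
  qed
  ultimately have "c * mean_cartan F x y \<alpha> = 0"
    using sqrt_not_quadratic[OF quadratic_mean_landsberg[OF y]] by blast
  then show ?thesis
    using iso[OF y, of \<alpha>] by (auto simp: mult_ac)
qed

end

section \<open>Finsler metrics in induced coordinates\<close>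

lemma manifold_chart:
  assumes "smooth_manifold X A" "c \<in> A"
  shows "is_chart X c"
  using assms by (simp add: smooth_manifold_def)

lemma chart_open_image:
  assumes "smooth_manifold X A" "c \<in> A"
  shows "open (snd c ` fst c)"
  using manifold_chart[OF assms] by (simp add: is_chart_def)

lemma chart_domain_subset:
  assumes "smooth_manifold X A" "c \<in> A"
  shows "fst c \<subseteq> topspace X"
  using manifold_chart[OF assms] by (simp add: is_chart_def openin_subset)

lemma chart_inj_on:
  assumes "smooth_manifold X A" "c \<in> A"
  shows "inj_on (snd c) (fst c)"
proof -
  have "topspace (subtopology X (fst c)) = fst c"
    using chart_domain_subset[OF assms] by auto
  then show ?thesis
    using manifold_chart[OF assms] homeomorphic_imp_injective_map unfolding is_chart_def by metis
qed

lemma chart_pt_coord: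
  assumes "smooth_manifold X A" "c \<in> A" "q \<in> fst c"
  shows "chart_pt c (snd c q) = q"
  using inv_into_f_f[OF chart_inj_on[OF assms(1,2)] assms(3)] by (simp add: chart_pt_def)

lemma coord_chart_pt:
  assumes "x \<in> snd c ` fst c"
  shows "snd c (chart_pt c x) = x" "chart_pt c x \<in> fst c"
  using assms by (simp_all add: chart_pt_def f_inv_into_f inv_into_into)

lemma chart_overlap_open:
  assumes "smooth_manifold X A" "c \<in> A" "d \<in> A"
  shows "open (snd c ` (fst c \<inter> fst d))"
proof -
  note c = manifold_chart[OF assms(1,2)] and d = manifold_chart[OF assms(1,3)]
  have "openin (subtopology X (fst c)) (fst c \<inter> fst d)"
    using d by (auto simp: is_chart_def openin_subtopology)
  moreover have "open_map (subtopology X (fst c)) (top_of_set (snd c ` fst c)) (snd c)"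
    using c by (simp add: is_chart_def homeomorphic_imp_open_map)
  ultimately have "openin (top_of_set (snd c ` fst c)) (snd c ` (fst c \<inter> fst d))"
    by (simp add: open_map_def)
  then show ?thesis
    using chart_open_image[OF assms(1,2)] by (rule openin_open_trans)
qed

lemma transition_has_derivative:
  assumes "smooth_manifold X A" "c \<in> A" "d \<in> A" "p \<in> fst c \<inter> fst d"
  shows "((snd d \<circ> chart_pt c) has_derivative frechet_derivative (snd d \<circ> chart_pt c) (at (snd c p)))
    (at (snd c p))"
proof -
  have "smooth_on (snd c ` (fst c \<inter> fst d)) (snd d \<circ> chart_pt c)"
    using assms by (simp add: smooth_manifold_def)
  then show ?thesis
    by (rule smooth_on_has_derivative) (use assms(4) in blast)
qed

text \<open>The chain rule for \<open>e \<circ> c\<^sup>-\<^sup>1 = (e \<circ> d\<^sup>-\<^sup>1) \<circ> (d \<circ> c\<^sup>-\<^sup>1)\<close>, which holds on the coordinate image of the overlap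
  of \<open>c\<close> and \<open>d\<close>; that image is open, so the identity determines the derivative.\<close>

lemma transition_derivative_cocycle:
  assumes M: "smooth_manifold X A" and "c \<in> A" "d \<in> A" "e \<in> A" and p: "p \<in> fst c" "p \<in> fst d" "p \<in> fst e"
  shows "frechet_derivative (snd e \<circ> chart_pt c) (at (snd c p)) y
    = frechet_derivative (snd e \<circ> chart_pt d) (at (snd d p))
        (frechet_derivative (snd d \<circ> chart_pt c) (at (snd c p)) y)"
proof -
  have cd: "((snd d \<circ> chart_pt c) has_derivative
      frechet_derivative (snd d \<circ> chart_pt c) (at (snd c p))) (at (snd c p))"
    using assms by (intro transition_has_derivative[OF M]) auto
  have de: "((snd e \<circ> chart_pt d) has_derivative
      frechet_derivative (snd e \<circ> chart_pt d) (at (snd d p))) (at ((snd d \<circ> chart_pt c) (snd c p)))"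
    using transition_has_derivative[OF M, of d e p] assms by (simp add: chart_pt_coord[OF M])
  have "((snd e \<circ> chart_pt c) has_derivative
      (\<lambda>y. frechet_derivative (snd e \<circ> chart_pt d) (at (snd d p))
        (frechet_derivative (snd d \<circ> chart_pt c) (at (snd c p)) y))) (at (snd c p))"
  proof (rule has_derivative_transform_within_open[OF has_derivative_compose[OF cd de]])
    show "open (snd c ` (fst c \<inter> fst d))"
      using assms by (intro chart_overlap_open[OF M]) auto
  qed (use assms in \<open>auto simp: chart_pt_coord[OF M]\<close>)
  from fun_cong[OF frechet_derivative_at[OF this], of y] show ?thesis
    by simp
qed

text \<open>The transformation law that defines tangent vectors is the cocycle property of the transition
  derivatives.\<close>

lemma tcoord_in_tangent_bundle:
  assumes M: "smooth_manifold X A" and c: "c \<in> A" and x: "x \<in> snd c ` fst c"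
  shows "tcoord A c x y \<in> tangent_bundle X A"
proof -
  define p where "p = chart_pt c x"
  have p: "p \<in> fst c"
    using coord_chart_pt[OF x] by (simp add: p_def)
  have "tvec_of A c p y e
      = frechet_derivative (snd e \<circ> chart_pt d) (at (snd d p)) (tvec_of A c p y d)"
    if "d \<in> A" "e \<in> A" "p \<in> fst d \<inter> fst e" for d e
    using transition_derivative_cocycle[OF M c that(1,2) p, of y] that by (simp add: tvec_of_def)
  moreover have "tvec_of A c p y e = 0" if "\<not> (e \<in> A \<and> p \<in> fst e)" for e
    using that by (auto simp: tvec_of_def)
  ultimately have "tvec_of A c p y \<in> tangent_space A p"
    unfolding tangent_space_def by blast
  then show ?thesis
    using chart_domain_subset[OF M c] p by (auto simp: tcoord_def tangent_bundle_def p_def)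
qed

lemma tcoord_scaleR:
  assumes M: "smooth_manifold X A" and c: "c \<in> A" and x: "x \<in> snd c ` fst c"
  shows "tcoord A c x (t *\<^sub>R y) = (chart_pt c x, \<lambda>d. t *\<^sub>R tvec_of A c (chart_pt c x) y d)"
proof -
  have "frechet_derivative (snd d \<circ> chart_pt c) (at (snd c (chart_pt c x))) (t *\<^sub>R y)
      = t *\<^sub>R frechet_derivative (snd d \<circ> chart_pt c) (at (snd c (chart_pt c x))) y"
    if "d \<in> A" "chart_pt c x \<in> fst d" for d
    by (rule linear_cmul[OF has_derivative_linear[OF transition_has_derivative[OF M c that(1)]]])
      (use that(2) coord_chart_pt[OF x] in simp)
  then show ?thesis
    by (auto simp: tcoord_def tvec_of_def fun_eq_iff)
qed

lemma local_metric_scaleR: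
  assumes "finsler_manifold X A F" "c \<in> A" "x \<in> snd c ` fst c" "t > 0"
  shows "local_metric A c F x (t *\<^sub>R y) = t * local_metric A c F x y"
proof -
  have M: "smooth_manifold X A" and F: "finsler_metric X A F"
    using assms(1) by (simp_all add: finsler_manifold_def)
  have "\<forall>(p, v)\<in>tangent_bundle X A. \<forall>s>0. F (p, (\<lambda>c. s *\<^sub>R v c)) = s * F (p, v)"
    using F by (simp add: finsler_metric_def)
  from bspec[OF this tcoord_in_tangent_bundle[OF M assms(2,3), of y]] show ?thesis
    using assms(4) by (simp add: local_metric_def tcoord_scaleR[OF M assms(2,3)]) (simp add: tcoord_def)
qed

lemma smooth_local_metric_sq:
  assumes "finsler_manifold X A F" "c \<in> A"
  shows "smooth_on ((snd c ` fst c) \<times> - {0}) (\<lambda>z. (local_metric A c F (fst z) (snd z))\<^sup>2)"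
proof -
  have "smooth_on ((snd c ` fst c) \<times> - {0}) (\<lambda>z. local_metric A c F (fst z) (snd z))"
    using assms by (simp add: finsler_manifold_def finsler_metric_def case_prod_unfold)
  moreover have "open ((snd c ` fst c) \<times> - {0 :: real^'b})"
    using assms by (intro open_Times open_compl_zero chart_open_image[where X = X])
      (simp_all add: finsler_manifold_def)
  ultimately show ?thesis
    unfolding power2_eq_square by (intro smooth_on_mult)
qed

lemma local_metric_pos_def:
  assumes "finsler_manifold X A F" "c \<in> A" "x \<in> snd c ` fst c" "y \<noteq> 0" "u \<noteq> 0"
  shows "u \<bullet> (half_hessian (\<lambda>w. (local_metric A c F x w)\<^sup>2) y *v u) > 0"
proof -
  have "fund_tensor (local_metric A c F) x y = half_hessian (\<lambda>w. (local_metric A c F x w)\<^sup>2) y"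
    by (simp add: fund_tensor_def half_hessian_def)
  moreover have "\<forall>c\<in>A. \<forall>x\<in>snd c ` fst c. \<forall>y. y \<noteq> 0 \<longrightarrow>
      (\<forall>u. u \<noteq> 0 \<longrightarrow> u \<bullet> (fund_tensor (local_metric A c F) x y *v u) > 0)"
    using assms(1) unfolding finsler_manifold_def finsler_metric_def by blast
  ultimately show ?thesis
    using assms(2-5) by (metis (no_types))
qed

text \<open>A function \<open>h\<close> on a coordinate domain times a slit fibre, such as \<open>F\<^sup>2\<close>, is differentiated below in the base
  direction at the point \<open>x\<close>; as a function on the fibre over \<open>x\<close> the result inherits the
  properties of \<open>h\<close>.\<close>

context
  fixes h :: "(real^'k::finite) \<times> (real^'k) \<Rightarrow> real" and S :: "(real^'k) set" and x :: "real^'k"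
  assumes S: "open S" and h: "smooth_on (S \<times> - {0}) h" and x: "x \<in> S"
begin

lemma smooth_on_fibre: "smooth_on (- {0}) (\<lambda>w. h (x, w))"
proof -
  have "bounded_linear (\<lambda>w :: real^'k. (0 :: real^'k, w))"
    by (intro bounded_linear_Pair bounded_linear_zero bounded_linear_ident)
  from smooth_on_affine_comp[OF open_compl_zero this, of "(x, 0)", OF _ h] show ?thesis
    using x by simp
qed

lemma base_has_derivative:
  assumes "w \<noteq> 0"
  shows "((\<lambda>u. h (u, w)) has_derivative (\<lambda>v. frechet_derivative h (at (x, w)) (v, 0))) (at x)"
  by (rule has_derivative_compose[where f = "\<lambda>u. (u, w)" and f' = "\<lambda>v. (v, 0)"])
    (use smooth_on_has_derivative[OF h] x assms in \<open>auto intro!: derivative_eq_intros\<close>)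

lemma base_pderiv_at:
  "w \<noteq> 0 \<Longrightarrow> frechet_derivative h (at (x, w)) (axis q 1, 0) = pderiv_at q (\<lambda>u. h (u, w)) x"
  by (simp add: pderiv_at_eqI[OF base_has_derivative])

lemma pos_homog_base_pderiv:
  assumes hom: "\<And>u. u \<in> S \<Longrightarrow> pos_homog k (\<lambda>w. h (u, w))"
  shows "pos_homog k (\<lambda>w. pderiv_at q (\<lambda>u. h (u, w)) x)"
  unfolding pos_homog_def
proof (intro allI impI)
  fix t :: real and w :: "real^'k"
  assume t: "t > 0" and w: "w \<noteq> 0"
  have "pderiv_at q (\<lambda>u. h (u, t *\<^sub>R w)) x = pderiv_at q (\<lambda>u. t powi k * h (u, w)) x"
    by (rule pderiv_at_cong_open[OF S x]) (use pos_homogD[OF hom] t w in blast)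
  also have "\<dots> = t powi k * pderiv_at q (\<lambda>u. h (u, w)) x"
    by (simp add: pderiv_at_eqI[OF has_derivative_mult_right[OF base_has_derivative[OF w]]]
        base_pderiv_at[OF w])
  finally show "pderiv_at q (\<lambda>u. h (u, t *\<^sub>R w)) x = t powi k * pderiv_at q (\<lambda>u. h (u, w)) x" .
qed

end

lemma smooth_on_base_pderiv:
  fixes h :: "(real^'k::finite) \<times> (real^'k) \<Rightarrow> real"
  assumes "open S" "smooth_on (S \<times> - {0}) h" "x \<in> S"
  shows "smooth_on (- {0}) (\<lambda>w. pderiv_at q (\<lambda>u. h (u, w)) x)"
  by (rule smooth_on_cong[OF open_compl_zero _
        smooth_on_fibre[OF assms(1) smooth_on_frechet_derivative[OF assms(2)] assms(3), of "(axis q 1, 0)"]])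
    (simp add: base_pderiv_at[OF assms])

section \<open>Isotropic mean Landsberg curvature of twisted products\<close>

theorem theorem5p4:
  fixes X1 :: "'a topology" and A1 :: "('a, 'm::finite) chart set"
    and F1 :: "'a \<times> ('a, 'm) tvec \<Rightarrow> real"
    and X2 :: "'b topology" and A2 :: "('b, 'n::finite) chart set"
    and F2 :: "'b \<times> ('b, 'n) tvec \<Rightarrow> real"
    and f :: "'a \<times> 'b \<Rightarrow> real"
  assumes "finsler_manifold X1 A1 F1" and "finsler_manifold X2 A2 F2"
    and "smooth_on_product A1 A2 f"
    and "\<And>p. p \<in> topspace X1 \<times> topspace X2 \<Longrightarrow> f p > 0"
  shows "rel_isotropic_mean_landsberg A1 A2 (twisted_product F1 f F2)
         \<longleftrightarrow> weakly_landsberg A1 A2 (twisted_product F1 f F2)"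
proof
  assume "weakly_landsberg A1 A2 (twisted_product F1 f F2)"
  then show "rel_isotropic_mean_landsberg A1 A2 (twisted_product F1 f F2)"
    unfolding weakly_landsberg_def rel_isotropic_mean_landsberg_def
    by (intro exI[of _ "\<lambda>_. 0"]) simp
next
  assume "rel_isotropic_mean_landsberg A1 A2 (twisted_product F1 f F2)"
  then obtain c where iso: "\<forall>c1\<in>A1. \<forall>c2\<in>A2. \<forall>(x, y)\<in>product_slit_domain c1 c2. \<forall>\<alpha>.
      mean_landsberg (local_product_metric A1 A2 c1 c2 (twisted_product F1 f F2)) x y \<alpha>
      + c (chart_pt c1 (fst_part x), chart_pt c2 (snd_part x))
        * local_product_metric A1 A2 c1 c2 (twisted_product F1 f F2) x y
        * mean_cartan (local_product_metric A1 A2 c1 c2 (twisted_product F1 f F2)) x y \<alpha> = 0"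
    unfolding rel_isotropic_mean_landsberg_def by blast
  have "mean_landsberg (local_product_metric A1 A2 c1 c2 (twisted_product F1 f F2)) x y \<alpha> = 0"
    if c1: "c1 \<in> A1" and c2: "c2 \<in> A2" and xy: "(x, y) \<in> product_slit_domain c1 c2" for c1 c2 x y \<alpha>
  proof -
    let ?F = "local_product_metric A1 A2 c1 c2 (twisted_product F1 f F2)"
    let ?S1 = "snd c1 ` fst c1" and ?S2 = "snd c2 ` fst c2"
    have x: "fst_part x \<in> ?S1" "snd_part x \<in> ?S2" and y: "y \<in> slit"
      using xy by (auto simp: product_slit_domain_def slit_def)
    have dom: "(x, z) \<in> product_slit_domain c1 c2" if "z \<in> slit" for z
      using x that by (simp add: product_slit_domain_def slit_def)
    have M: "smooth_manifold X1 A1" "smooth_manifold X2 A2"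
      using assms(1,2) by (simp_all add: finsler_manifold_def)
    have op: "open ?S1" "open ?S2"
      using chart_open_image[OF M(1) c1] chart_open_image[OF M(2) c2] .
    define h1 where "h1 z = (local_metric A1 c1 F1 (fst z) (snd z))\<^sup>2" for z
    define h2 where "h2 z = (local_metric A2 c2 F2 (fst z) (snd z))\<^sup>2" for z
    define \<psi> where "\<psi> z = (f (chart_pt c1 (fst z), chart_pt c2 (snd z)))\<^sup>2" for z
    have sm: "smooth_on (?S1 \<times> - {0}) h1" "smooth_on (?S2 \<times> - {0}) h2"
      using smooth_local_metric_sq[OF assms(1) c1] smooth_local_metric_sq[OF assms(2) c2]
      by (simp_all add: h1_def[abs_def] h2_def[abs_def])
    have hom: "pos_homog 2 (\<lambda>w. h1 (u, w))" "pos_homog 2 (\<lambda>w. h2 (u', w))"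
      if "u \<in> ?S1" "u' \<in> ?S2" for u u'
      using that local_metric_scaleR[OF assms(1) c1] local_metric_scaleR[OF assms(2) c2]
      by (simp_all add: pos_homog_def h1_def h2_def power_mult_distrib)
    have F_eq: "?F u z = sqrt (h1 (fst_part u, fst_part z) + \<psi> (fst_part u, snd_part u) * h2 (snd_part u, snd_part z))"
      for u z
      by (simp add: local_product_metric_def twisted_product_def h1_def h2_def \<psi>_def local_metric_def tcoord_def)
    then have F_sq: "(?F u z)\<^sup>2 = h1 (fst_part u, fst_part z) + \<psi> (fst_part u, snd_part u) * h2 (snd_part u, snd_part z)"
      for u z
      by (simp add: h1_def h2_def \<psi>_def)
    have "smooth_on (?S1 \<times> ?S2) (\<lambda>z. f (chart_pt c1 (fst z), chart_pt c2 (snd z)))"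
      using assms(3) c1 c2 by (simp add: smooth_on_product_def case_prod_unfold)
    then have "smooth_on (?S1 \<times> ?S2) \<psi>"
      unfolding \<psi>_def[abs_def] power2_eq_square by (intro smooth_on_mult open_Times op)
    then have d\<psi>: "(\<psi> has_derivative frechet_derivative \<psi> (at (fst_part x, snd_part x)))
        (at (fst_part x, snd_part x))"
      by (rule smooth_on_has_derivative) (use x in simp)
    \<comment> \<open>The gradient of \<open>f\<^sup>2\<close> in product coordinates, where \<open>\<psi>\<close> takes a pair of coordinate vectors.\<close>
    define d where "d q = frechet_derivative \<psi> (at (fst_part x, snd_part x)) (fst_part (axis q 1), snd_part (axis q 1))"
      for q :: "'m + 'n"
    note lin = bounded_linear_imp_has_derivative[OF bounded_linear_fst_part]
      bounded_linear_imp_has_derivative[OF bounded_linear_snd_part]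
    have pd: "pderiv_at q (\<lambda>u. (?F u z)\<^sup>2) x =
        frechet_derivative h1 (at (fst_part x, fst_part z)) (fst_part (axis q 1), 0)
        + (\<psi> (fst_part x, snd_part x) * frechet_derivative h2 (at (snd_part x, snd_part z)) (snd_part (axis q 1), 0)
          + d q * h2 (snd_part x, snd_part z))" if z: "z \<in> slit" for z q
      unfolding F_sq d_def
      by (rule pderiv_at_eqI[OF has_derivative_add[OF
              has_derivative_compose[OF lin(1) base_has_derivative[OF op(1) sm(1) x(1)]]
              has_derivative_mult[OF has_derivative_compose[OF has_derivative_Pair[OF lin] d\<psi>]
                has_derivative_compose[OF lin(2) base_has_derivative[OF op(2) sm(2) x(2)]]]]])
        (use z in \<open>simp_all add: slit_def\<close>)
    have zero: "frechet_derivative h1 (at (fst_part x, fst_part z)) (0, 0) = 0"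
      "frechet_derivative h2 (at (snd_part x, snd_part z)) (0, 0) = 0" if "z \<in> slit" for z
      using linear_0[OF has_derivative_linear[OF base_has_derivative[OF op(1) sm(1) x(1)]]]
        linear_0[OF has_derivative_linear[OF base_has_derivative[OF op(2) sm(2) x(2)]]] that
      by (simp_all add: slit_def)
    interpret twisted_fibre ?F x "\<lambda>w. h1 (fst_part x, w)" "\<lambda>w. h2 (snd_part x, w)"
      "\<lambda>q w. pderiv_at q (\<lambda>u. h1 (u, w)) (fst_part x)" "\<lambda>q w. pderiv_at q (\<lambda>u. h2 (u, w)) (snd_part x)"
      "\<psi> (fst_part x, snd_part x)" d
    proof
      have "f (chart_pt c1 (fst_part x), chart_pt c2 (snd_part x)) > 0"
        using coord_chart_pt(2)[OF x(1)] coord_chart_pt(2)[OF x(2)]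
          chart_domain_subset[OF M(1) c1] chart_domain_subset[OF M(2) c2]
        by (intro assms(4)) blast
      then show "\<psi> (fst_part x, snd_part x) > 0"
        by (simp add: \<psi>_def)
      show "pderiv_at (Inl q) (\<lambda>u. (?F u z)\<^sup>2) x
          = pderiv_at q (\<lambda>u. h1 (u, fst_part z)) (fst_part x) + d (Inl q) * h2 (snd_part x, snd_part z)"
        if "z \<in> slit" for z q
        using that by (simp add: pd zero base_pderiv_at[OF op(1) sm(1) x(1)]) (simp add: slit_def base_pderiv_at[OF op(1) sm(1) x(1)])
      show "pderiv_at (Inr r) (\<lambda>u. (?F u z)\<^sup>2) x = d (Inr r) * h2 (snd_part x, snd_part z)
          + \<psi> (fst_part x, snd_part x) * pderiv_at r (\<lambda>u. h2 (u, snd_part z)) (snd_part x)"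
        if "z \<in> slit" for z r
        using that by (simp add: pd zero) (simp add: slit_def base_pderiv_at[OF op(2) sm(2) x(2)])
    qed (use F_eq smooth_on_fibre[OF op(1) sm(1) x(1)] smooth_on_fibre[OF op(2) sm(2) x(2)]
        smooth_on_base_pderiv[OF op(1) sm(1) x(1)] smooth_on_base_pderiv[OF op(2) sm(2) x(2)]
        hom[OF x] pos_homog_base_pderiv[OF op(2) sm(2) x(2) hom(2)[OF x(1)]]
        local_metric_pos_def[OF assms(1) c1 x(1)] local_metric_pos_def[OF assms(2) c2 x(2)]
        in \<open>simp_all add: h1_def h2_def\<close>)
    show ?thesis
    proof (rule isotropic_imp_mean_landsberg_zero[OF _ y])
      show "mean_landsberg ?F x z \<beta> + c (chart_pt c1 (fst_part x), chart_pt c2 (snd_part x))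
          * ?F x z * mean_cartan ?F x z \<beta> = 0" if "z \<in> slit" for z \<beta>
        using iso c1 c2 dom[OF that] by fast
    qed
  qed
  then show "weakly_landsberg A1 A2 (twisted_product F1 f F2)"
    by (auto simp: weakly_landsberg_def)
qed

end
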